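(* Let $\mathcal H=(V,E)$ be a connected hypergraph with a fixed ribbon structure, base node and base edge on $\mathrm{Bip}\,\mathcal H$. The set of final current graphs of the (ht:$E$, cut:$V$) Bernardi process, as $\mathbf f$ ranges over all hypertrees on $E$, equals the set of $V$-cut Jaeger trees; the same holds for the (ht:$V$, cut:$V$) Bernardi process as $\mathbf f$ ranges over all hypertrees on $V$. Likewise, the outcomes of the (ht:$E$, cut:$E$) Bernardi process (over all hypertrees on $E$), as well as the outcomes of the (ht:$V$, cut:$E$) Bernardi process (over all hypertrees on $V$), are exactly the $E$-cut Jaeger trees.
   Context: $\mathcal H=(V,E)$: $V$ finite set, $E$ finite multiset of nonempty subsets of $V$; $\mathrm{Bip}\,\mathcal H$ has color classes $V$ (violet) and $E$ (emerald), $v$ joined to $e$ iff $v\in e$; connected means $\mathrm{Bip}\,\mathcal H$ connected. A ribbon structure assigns to each node $x$ a cyclic permutation of its incident edges; $xy^+$ is the edge following $xy$ at $x$; subgraphs inherit restricted orders ($xy^+_G$ in subgraph $G$). Base node $b_0$, incident base edge $b_0b_1$. A hypertree on $E$ is $\mathbf f:E\to\mathbb Z_{\ge0}$ such that some spanning tree $T$ has $d_T(e)=\mathbf f(e)+1$ for all $e\in E$; symmetrically on $V$. Bernardi processes, $X\in\{E,V\}$, $\mathbf f$ a hypertree on $X$, current graph $G$ initially $\mathrm{Bip}\,\mathcal H$; the outcome is the final current graph. (ht:$X$, cut:$V$): if $b_0\in V$ start with current edge $b_0b_1$; if $b_0\in E$ start with $b_1b_0^+$, $b_0b_1$ counting as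 traversed from $b_0$. With current edge $ve$ ($v\in V$): if $\mathbf f$ is a hypertree on $X$ in $G-ve$, remove $ve$ and make $ve^+_G$ current; otherwise traverse $ve$ from $v$ and $ew:=ev^+_G$ from $e$, and make $we^+_G$ current. (ht:$X$, cut:$E$): if $b_0\in E$ start with $b_0b_1$; if $b_0\in V$ start with $b_1b_0^+$, $b_0b_1$ counting as traversed from $b_0$. With current edge $ev$ ($e\in E$): if $\mathbf f$ is a hypertree on $X$ in $G-ev$, remove $ev$ and make $ev^+_G$ current; otherwise traverse $ev$ from $e$ and $vd:=ve^+_G$ from $v$, and make $dv^+_G$ current. Each process stops right before an edge would be traversed a second time from the same endpoint. Tour of a spanning tree $T$: pairs (current node, current edge) starting with $(b_0,b_0b_1)$; from $(x,xy)$ go to $(x,xy^+)$ if $xy\notin T$, to $(y,yx^+)$ if $xy\in T$; stop right before $(b_0,b_0b_1)$ recurs. Each edge $xy$ appears exactly twice, as $(x,xy)$ and $(y,xy)$; a non-edge $xy$ is cut at $x$ if $(x,xy)$ comes first. $T$ is a $V$-cut (resp. $E$-cut) Jaeger tree if every non-edge of $T$ is cut at its violet (resp. emerald) endpoint. *)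

theory Defs
  imports "HOL-Combinatorics.Orbits" "HOL-Library.While_Combinator"
begin

text \<open>
  The multiset of hyperedges is given as a finite family: \<open>E\<close> is the index set and \<open>inc e\<close> is
  the subset of \<open>V\<close> belonging to \<open>e\<close>, so repeated hyperedges are distinct indices.
\<close>

definition hypergraph :: "'v set \<Rightarrow> 'e set \<Rightarrow> ('e \<Rightarrow> 'v set) \<Rightarrow> bool" where
  "hypergraph V E inc \<longleftrightarrow>
     finite V \<and> finite E \<and> (\<forall>e\<in>E. inc e \<noteq> {} \<and> inc e \<subseteq> V)"

definition violet :: "'v set \<Rightarrow> ('v + 'e) set" where
  "violet V = Inl ` V"

definition emerald :: "'e set \<Rightarrow> ('v + 'e) set" where
  "emerald E = Inr ` E"

definition bip_nodes :: "'v set \<Rightarrow> 'e set \<Rightarrow> ('v + 'e) set" where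
  "bip_nodes V E = violet V \<union> emerald E"

definition bip_edges :: "'e set \<Rightarrow> ('e \<Rightarrow> 'v set) \<Rightarrow> ('v + 'e) set set" where
  "bip_edges E inc = {{Inl v, Inr e} | v e. e \<in> E \<and> v \<in> inc e}"

text \<open>
  A subgraph is identified with its set of edges, an edge being a two-element set of nodes; all
  subgraphs considered contain every node of the node set \<open>N\<close>.
\<close>

definition connected_graph :: "'n set \<Rightarrow> 'n set set \<Rightarrow> bool" where
  "connected_graph N G \<longleftrightarrow> (\<forall>x\<in>N. \<forall>y\<in>N. (x, y) \<in> {(a, b). {a, b} \<in> G}\<^sup>*)"

definition is_cycle :: "'n set set \<Rightarrow> 'n list \<Rightarrow> bool" where
  "is_cycle G p \<longleftrightarrow>
     length p \<ge> 3 \<and> distinct p \<and> successively (\<lambda>a b. {a, b} \<in> G) p \<and> {last p, hd p} \<in> G"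

definition spanning_tree :: "'n set \<Rightarrow> 'n set set \<Rightarrow> 'n set set \<Rightarrow> bool" where
  "spanning_tree N G T \<longleftrightarrow> T \<subseteq> G \<and> connected_graph N T \<and> (\<nexists>p. is_cycle T p)"

definition degree :: "'n set set \<Rightarrow> 'n \<Rightarrow> nat" where
  "degree T x = card {a \<in> T. x \<in> a}"

text \<open>Only the values of \<open>f\<close> on \<open>X\<close> are relevant.\<close>

definition hypertree :: "'n set \<Rightarrow> 'n set set \<Rightarrow> 'n set \<Rightarrow> ('n \<Rightarrow> nat) \<Rightarrow> bool" where
  "hypertree N G X f \<longleftrightarrow> (\<exists>T. spanning_tree N G T \<and> (\<forall>x\<in>X. degree T x = f x + 1))"

text \<open>
  Since the graph is simple, an edge incident to \<open>x\<close> is named by its other endpoint: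
  \<open>\<sigma> x y = z\<close> means that the edge \<open>xy\<^sup>+\<close> following \<open>xy\<close> at \<open>x\<close> is \<open>xz\<close>.
\<close>

definition ribbon_structure :: "'n set \<Rightarrow> 'n set set \<Rightarrow> ('n \<Rightarrow> 'n \<Rightarrow> 'n) \<Rightarrow> bool" where
  "ribbon_structure N B \<sigma> \<longleftrightarrow> (\<forall>x\<in>N. cyclic_on (\<sigma> x) {y. {x, y} \<in> B})"

text \<open>The far endpoint of \<open>xy\<^sup>+\<^sub>G\<close>, for the cyclic order at \<open>x\<close> restricted to the subgraph \<open>G\<close>.\<close>

definition succ_in :: "('n \<Rightarrow> 'n \<Rightarrow> 'n) \<Rightarrow> 'n set set \<Rightarrow> 'n \<Rightarrow> 'n \<Rightarrow> 'n" where
  "succ_in \<sigma> G x y = (\<sigma> x ^^ (LEAST k. k \<ge> 1 \<and> {x, (\<sigma> x ^^ k) y} \<in> G)) y"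

text \<open>
  Bernardi processes. A state consists of the current graph, the current edge \<open>xy\<close> written as
  the pair \<open>(x, y)\<close> with \<open>x\<close> in the cut class \<open>C\<close>, and the set of those \<open>(z, w)\<close> for which
  the edge \<open>zw\<close> has been traversed from \<open>z\<close>.
\<close>

type_synonym 'n bernardi_state = "'n set set \<times> ('n \<times> 'n) \<times> ('n \<times> 'n) set"

definition bernardi_init ::
    "'n set set \<Rightarrow> ('n \<Rightarrow> 'n \<Rightarrow> 'n) \<Rightarrow> 'n \<Rightarrow> 'n \<Rightarrow> 'n set \<Rightarrow> 'n bernardi_state" where
  "bernardi_init B \<sigma> b0 b1 C =
     (if b0 \<in> C then (B, (b0, b1), {}) else (B, (b1, \<sigma> b1 b0), {(b0, b1)}))"

fun bernardi_stops ::
    "'n set \<Rightarrow> ('n \<Rightarrow> 'n \<Rightarrow> 'n) \<Rightarrow> 'n set \<Rightarrow> ('n \<Rightarrow> nat) \<Rightarrow> 'n bernardi_state \<Rightarrow> bool" where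
  "bernardi_stops N \<sigma> X f (G, (x, y), R) \<longleftrightarrow>
     \<not> hypertree N (G - {{x, y}}) X f \<and> ((x, y) \<in> R \<or> (y, succ_in \<sigma> G y x) \<in> R)"

fun bernardi_step ::
    "'n set \<Rightarrow> ('n \<Rightarrow> 'n \<Rightarrow> 'n) \<Rightarrow> 'n set \<Rightarrow> ('n \<Rightarrow> nat) \<Rightarrow> 'n bernardi_state \<Rightarrow> 'n bernardi_state" where
  "bernardi_step N \<sigma> X f (G, (x, y), R) =
     (if hypertree N (G - {{x, y}}) X f
      then (G - {{x, y}}, (x, succ_in \<sigma> G x y), R)
      else let w = succ_in \<sigma> G y x
           in (G, (w, succ_in \<sigma> G w y), insert (x, y) (insert (y, w) R)))"

text \<open>
  The outcome of the (ht:\<open>X\<close>, cut:\<open>C\<close>) process on \<open>f\<close>. Every step removes an edge or enlarges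
  the set of traversals, so the loop terminates whenever \<open>f\<close> is a hypertree.
\<close>

definition bernardi_outcome ::
    "'n set \<Rightarrow> 'n set set \<Rightarrow> ('n \<Rightarrow> 'n \<Rightarrow> 'n) \<Rightarrow> 'n \<Rightarrow> 'n \<Rightarrow> 'n set \<Rightarrow> 'n set \<Rightarrow> ('n \<Rightarrow> nat) \<Rightarrow> 'n set set" where
  "bernardi_outcome N B \<sigma> b0 b1 X C f =
     fst (while (\<lambda>s. \<not> bernardi_stops N \<sigma> X f s) (bernardi_step N \<sigma> X f)
            (bernardi_init B \<sigma> b0 b1 C))"

definition bernardi_outcomes ::
    "'n set \<Rightarrow> 'n set set \<Rightarrow> ('n \<Rightarrow> 'n \<Rightarrow> 'n) \<Rightarrow> 'n \<Rightarrow> 'n \<Rightarrow> 'n set \<Rightarrow> 'n set \<Rightarrow> 'n set set set" where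
  "bernardi_outcomes N B \<sigma> b0 b1 X C = bernardi_outcome N B \<sigma> b0 b1 X C ` {f. hypertree N B X f}"

text \<open>Tours of spanning trees; the pair (current node \<open>x\<close>, current edge \<open>xy\<close>) is written \<open>(x, y)\<close>.\<close>

fun tour_step :: "('n \<Rightarrow> 'n \<Rightarrow> 'n) \<Rightarrow> 'n set set \<Rightarrow> 'n \<times> 'n \<Rightarrow> 'n \<times> 'n" where
  "tour_step \<sigma> T (x, y) = (if {x, y} \<in> T then (y, \<sigma> y x) else (x, \<sigma> x y))"

definition tour :: "('n \<Rightarrow> 'n \<Rightarrow> 'n) \<Rightarrow> 'n \<Rightarrow> 'n \<Rightarrow> 'n set set \<Rightarrow> ('n \<times> 'n) list" where
  "tour \<sigma> b0 b1 T =
     map (\<lambda>k. (tour_step \<sigma> T ^^ k) (b0, b1))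
       [0..<(LEAST k. k \<ge> 1 \<and> (tour_step \<sigma> T ^^ k) (b0, b1) = (b0, b1))]"

text \<open>\<open>xy\<close> is cut at \<open>x\<close>: in the tour, \<open>(x, xy)\<close> comes before \<open>(y, xy)\<close>.\<close>

definition cut_at :: "('n \<Rightarrow> 'n \<Rightarrow> 'n) \<Rightarrow> 'n \<Rightarrow> 'n \<Rightarrow> 'n set set \<Rightarrow> 'n \<Rightarrow> 'n \<Rightarrow> bool" where
  "cut_at \<sigma> b0 b1 T x y \<longleftrightarrow>
     (\<exists>i j. i < j \<and> j < length (tour \<sigma> b0 b1 T) \<and>
        tour \<sigma> b0 b1 T ! i = (x, y) \<and> tour \<sigma> b0 b1 T ! j = (y, x))"

definition jaeger_tree ::
    "'n set \<Rightarrow> 'n set set \<Rightarrow> ('n \<Rightarrow> 'n \<Rightarrow> 'n) \<Rightarrow> 'n \<Rightarrow> 'n \<Rightarrow> 'n set \<Rightarrow> 'n set set \<Rightarrow> bool" where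
  "jaeger_tree N B \<sigma> b0 b1 C T \<longleftrightarrow>
     spanning_tree N B T \<and>
     (\<forall>x y. x \<in> C \<and> {x, y} \<in> B - T \<longrightarrow> cut_at \<sigma> b0 b1 T x y)"

end

theory Submission
  imports Defs
begin

text \<open>
  Write \<open>C\<close> for the colour class at which edges are cut, \<open>D\<close> for the other one and \<open>X\<close> for the
  class carrying the hypertree. Adding an edge \<open>xy\<close> to a forest composes the tour permutation with
  the transposition of \<open>(x, y)\<close> and \<open>(y, x)\<close>, which joins two cycles; hence the tour of a tree \<open>T\<close>
  is a single cycle, and between \<open>(x, y)\<close> and \<open>(y, x)\<close> it sees exactly the nodes on the side of \<open>y\<close>
  of \<open>T - xy\<close>.

  Let \<open>T\<close> be a Jaeger tree with the degrees prescribed by \<open>f\<close>. The process follows the tour of \<open>T\<close>: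
  non-edges of \<open>T\<close> can clearly be removed. When an edge \<open>xy\<close> of \<open>T\<close> is met at \<open>x \<in> C\<close>, every other
  edge of its fundamental cut that is still present has its \<open>C\<close>-end on the side of \<open>y\<close>, and counting
  the edges at the nodes of \<open>X\<close> on one side shows that no spanning tree avoiding \<open>xy\<close> has the same
  degrees on \<open>X\<close>. So the outcome is \<open>T\<close>.

  Every hypertree comes from a Jaeger tree: among the trees with the prescribed degrees take the one
  whose tour lexicographically prefers to cut at \<open>C\<close> and to keep at \<open>D\<close>. If \<open>xy\<close> were cut
  at \<open>y \<in> D\<close>, then exchanging it for the edge of its fundamental cycle that meets it at its
  endpoint in \<open>X\<close> would preserve the degrees on \<open>X\<close> and improve the tour.
\<close>

subsection \<open>Forests\<close>

definition reach :: "'n set set \<Rightarrow> 'n \<Rightarrow> 'n \<Rightarrow> bool" where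
  "reach G x y \<longleftrightarrow> (x, y) \<in> {(a, b). {a, b} \<in> G}\<^sup>*"

lemma reach_refl [simp]: "reach G x x"
  by (simp add: reach_def)

lemma reach_edge: "{x, y} \<in> G \<Longrightarrow> reach G x y"
  by (auto simp: reach_def)

lemma reach_trans: "reach G x y \<Longrightarrow> reach G y z \<Longrightarrow> reach G x z"
  by (auto simp: reach_def)

lemma reach_sym: "reach G x y \<Longrightarrow> reach G y x"
proof -
  have "sym {(a, b). {a, b} \<in> G}"
    by (auto simp: sym_def insert_commute)
  then show "reach G x y \<Longrightarrow> reach G y x"
    unfolding reach_def by (meson sym_rtrancl symD)
qed

lemma reach_mono: "reach G x y \<Longrightarrow> G \<subseteq> H \<Longrightarrow> reach H x y"
  unfolding reach_def by (erule rtrancl_mono[THEN subsetD, rotated]) auto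

lemma reach_induct [consumes 1, case_names refl step]:
  assumes "reach G x y" and "P x"
    and "\<And>y z. reach G x y \<Longrightarrow> {y, z} \<in> G \<Longrightarrow> P y \<Longrightarrow> P z"
  shows "P y"
  using assms(1) unfolding reach_def
  by (induction rule: rtrancl_induct) (use assms(2,3) in \<open>auto simp: reach_def\<close>)

lemma reach_empty [simp]: "reach {} x y \<longleftrightarrow> x = y"
  by (simp add: reach_def)

lemma connected_graph_reach: "connected_graph N G \<longleftrightarrow> (\<forall>x\<in>N. \<forall>y\<in>N. reach G x y)"
  by (simp add: connected_graph_def reach_def)

text \<open>Crossing the new edge once is enough: by a second crossing both its ends have been
  visited, so the detour can be cut out.\<close>

lemma reach_insert:
  "reach (insert {a, b} G) u v \<longleftrightarrow>
     reach G u v \<or> (reach G u a \<and> reach G b v) \<or> (reach G u b \<and> reach G a v)"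
  (is "?L \<longleftrightarrow> ?R")
proof
  assume ?L
  then show ?R
  proof (induction rule: reach_induct)
    case (step y z)
    from step.hyps(2) consider "{y, z} \<in> G" | "y = a" "z = b" | "y = b" "z = a"
      by (auto simp: doubleton_eq_iff)
    then show ?case
    proof cases
      case 1
      then show ?thesis
        using step.IH by (meson reach_edge reach_trans)
    qed (use step.IH in \<open>metis reach_refl\<close>)+
  qed simp
next
  let ?G = "insert {a, b} G"
  have "reach ?G a b" "reach ?G b a"
    by (auto intro: reach_edge reach_sym)
  moreover have "reach ?G x y" if "reach G x y" for x y
    using that by (rule reach_mono) auto
  ultimately show "?R \<Longrightarrow> ?L"
    by (meson reach_trans)
qed

lemma reach_distinct_path:
  assumes "reach G x y"
  obtains p where "p \<noteq> []" "hd p = x" "last p = y" "distinct p"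
    "successively (\<lambda>a b. {a, b} \<in> G) p"
proof -
  have "\<exists>p. p \<noteq> [] \<and> hd p = x \<and> last p = y \<and> distinct p \<and> successively (\<lambda>a b. {a, b} \<in> G) p"
    using assms unfolding reach_def
  proof (induction rule: converse_rtrancl_induct)
    case base
    then show ?case
      by (intro exI[of _ "[y]"]) auto
  next
    case (step x x')
    then obtain p where p: "p \<noteq> []" "hd p = x'" "last p = y" "distinct p"
      "successively (\<lambda>a b. {a, b} \<in> G) p"
      by blast
    show ?case
    proof (cases "x \<in> set p")
      case True
      \<comment> \<open>The path already passes through \<open>x\<close>; its tail from there is a
        path as required.\<close>
      then obtain p1 p2 where "p = p1 @ x # p2"
        by (meson split_list)
      then show ?thesis
        using p by (intro exI[of _ "x # p2"]) (auto simp: successively_append_iff)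
    next
      case False
      then show ?thesis
        using p step.hyps(1) by (intro exI[of _ "x # p"]) (auto simp: successively_Cons)
    qed
  qed
  then show thesis
    using that by blast
qed

lemma reach_first_edge:
  assumes "reach G y x" and "x \<noteq> y"
  obtains z where "{y, z} \<in> G" "reach (G - {{y, z}}) z x"
proof -
  have "x = y \<or> (\<exists>z. {y, z} \<in> G \<and> reach (G - {{y, z}}) z x)"
    using assms(1)
  proof (induction rule: reach_induct)
    case (step x x')
    show ?case
    proof (cases "x = y \<or> x' = y")
      case True
      then show ?thesis
        using step.hyps(2) by auto
    next
      case False
      then obtain z where z: "{y, z} \<in> G" "reach (G - {{y, z}}) z x"
        using step.IH by blast
      moreover have "reach (G - {{y, z}}) x x'"
        using step.hyps(2) False by (intro reach_edge) (auto simp: doubleton_eq_iff)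
      ultimately show ?thesis
        by (meson reach_trans)
    qed
  qed simp
  then show thesis
    using that assms(2) by blast
qed

text \<open>Acyclicity in local form: every edge is a bridge. Since \<open>reach\<close> is
  reflexive, loops are excluded as well.\<close>

definition forest :: "'n set set \<Rightarrow> bool" where
  "forest G \<longleftrightarrow> (\<forall>x y. {x, y} \<in> G \<longrightarrow> \<not> reach (G - {{x, y}}) x y)"

lemma forestD: "forest G \<Longrightarrow> {x, y} \<in> G \<Longrightarrow> \<not> reach (G - {{x, y}}) x y"
  by (simp add: forest_def)

lemma forest_subset: "forest G \<Longrightarrow> H \<subseteq> G \<Longrightarrow> forest H"
  unfolding forest_def by (meson Diff_mono reach_mono subsetD subset_refl)

lemma forest_insertD: "forest (insert {a, b} G) \<Longrightarrow> {a, b} \<notin> G \<Longrightarrow> \<not> reach G a b"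
  using forestD[of "insert {a, b} G" a b] by simp

text \<open>If an old edge \<open>uv\<close> ceased to be a bridge, the detour replacing it would
  cross \<open>ab\<close>; together with \<open>uv\<close> it would connect \<open>a\<close> to
  \<open>b\<close> inside \<open>G\<close>.\<close>

lemma forest_insert:
  assumes F: "forest G" and ab: "\<not> reach G a b"
  shows "forest (insert {a, b} G)"
  unfolding forest_def
proof (intro allI impI notI)
  fix u v
  assume uv: "{u, v} \<in> insert {a, b} G"
    and r: "reach (insert {a, b} G - {{u, v}}) u v"
  have "{a, b} \<notin> G"
    using ab reach_edge by metis
  show False
  proof (cases "{u, v} = {a, b}")
    case True
    then have "reach G u v"
      using r \<open>{a, b} \<notin> G\<close> by (simp add: insert_Diff_if)
    then show False
      using True ab reach_sym by (metis doubleton_eq_iff)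
  next
    case False
    then have uvG: "{u, v} \<in> G" and
      eq: "insert {a, b} G - {{u, v}} = insert {a, b} (G - {{u, v}})"
      using uv by auto
    have m: "reach G x y" if "reach (G - {{u, v}}) x y" for x y
      using that by (rule reach_mono) auto
    have "\<not> reach (G - {{u, v}}) u v"
      using F uvG by (rule forestD)
    then have "reach G u a \<and> reach G b v \<or> reach G u b \<and> reach G a v"
      using r unfolding eq reach_insert by (auto dest: m)
    then show False
      using ab reach_edge[OF uvG] by (meson reach_sym reach_trans)
  qed
qed

text \<open>A cycle without its closing edge is a walk between the ends of that edge, and
  conversely. Loops are set aside by the hypothesis: \<open>is_cycle\<close> needs three nodes and
  does not see them, whereas \<open>forest\<close> forbids them.\<close>

lemma acyclic_iff_forest:
  assumes "\<And>x. {x} \<notin> G"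
  shows "(\<nexists>p. is_cycle G p) \<longleftrightarrow> forest G"
proof
  assume ac: "\<nexists>p. is_cycle G p"
  show "forest G"
    unfolding forest_def
  proof (intro allI impI notI)
    fix x y
    assume xy: "{x, y} \<in> G" and r: "reach (G - {{x, y}}) x y"
    obtain p where p: "p \<noteq> []" "hd p = x" "last p = y" "distinct p"
      "successively (\<lambda>a b. {a, b} \<in> G - {{x, y}}) p"
      by (rule reach_distinct_path[OF r])
    have "x \<noteq> y"
      using xy assms by auto
    have "length p \<ge> 3"
    proof (rule ccontr)
      assume "\<not> 3 \<le> length p"
      then consider a where "p = [a]" | a b where "p = [a, b]"
        using p(1) by (cases p; cases "tl p"; cases "tl (tl p)") auto
      then show False
        using p \<open>x \<noteq> y\<close> by cases auto
    qed
    then have "is_cycle G p"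
      using p xy unfolding is_cycle_def
      by (auto simp: insert_commute elim: successively_mono)
    then show False
      using ac by blast
  qed
next
  assume F: "forest G"
  show "\<nexists>p. is_cycle G p"
  proof
    assume "\<exists>p. is_cycle G p"
    then obtain p where p: "length p \<ge> 3" "distinct p" "successively (\<lambda>a b. {a, b} \<in> G) p"
      "{last p, hd p} \<in> G"
      unfolding is_cycle_def by blast
    define n where "n = length p - 1"
    have n: "n \<ge> 2" "length p = Suc n"
      using p(1) by (auto simp: n_def)
    have ends: "hd p = p ! 0" "last p = p ! n"
      using n hd_conv_nth[of p] last_conv_nth[of p] by (cases p; simp)+
    have "reach (G - {{p ! n, p ! 0}}) (p ! 0) (p ! i)" if "i \<le> n" for i
      using that
    proof (induction i)
      case (Suc i)
      have "{p ! i, p ! Suc i} \<in> G"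
        using p(3) Suc.prems n by (auto simp: successively_conv_nth)
      moreover have "{p ! i, p ! Suc i} \<noteq> {p ! n, p ! 0}"
        using p(2) Suc.prems n by (auto simp: doubleton_eq_iff nth_eq_iff_index_eq)
      ultimately have "reach (G - {{p ! n, p ! 0}}) (p ! i) (p ! Suc i)"
        by (intro reach_edge) auto
      then show ?case
        using Suc by (meson Suc_leD reach_trans)
    qed simp
    from this[of n] show False
      using forestD[OF F p(4)] ends by (metis order_refl reach_sym)
  qed
qed

text \<open>The image set consists of the connected components on \<open>S\<close>. Every new edge
  merges two of them, so edges plus components stays constant.\<close>

lemma forest_card:
  assumes "finite S" and "forest F" and "\<And>e. e \<in> F \<Longrightarrow> \<exists>x\<in>S. \<exists>y\<in>S. e = {x, y}"
  shows "finite F \<and> card F + card ((\<lambda>x. {y \<in> S. reach F x y}) ` S) = card S"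
proof -
  have "F \<subseteq> Pow S"
    using assms(3) by blast
  then have "finite F"
    using assms(1) finite_subset by blast
  then have "card F + card ((\<lambda>x. {y \<in> S. reach F x y}) ` S) = card S"
    using assms(2,3)
  proof (induction F rule: finite_induct)
    case empty
    have "inj_on (\<lambda>x. {y \<in> S. x = y}) S"
      by (auto simp: inj_on_def)
    then show ?case
      by (simp add: card_image)
  next
    case (insert e F)
    then obtain a b where ab: "a \<in> S" "b \<in> S" "e = {a, b}"
      using insert.prems(2)[of e] by blast
    define q where "q x = {y \<in> S. reach F x y}" for x
    define q' where "q' x = {y \<in> S. reach (Set.insert e F) x y}" for x
    have nab: "\<not> reach F a b"
      by (rule forest_insertD) (use insert.hyps(2) insert.prems(1) ab(3) in \<open>simp_all only: simp_thms\<close>)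
    have q_eq: "q x = q y \<longleftrightarrow> reach F x y" if "x \<in> S" "y \<in> S" for x y
    proof
      assume "q x = q y"
      moreover have "y \<in> q y"
        using that by (simp add: q_def)
      ultimately have "y \<in> q x"
        by simp
      then show "reach F x y"
        by (simp add: q_def)
    next
      assume "reach F x y"
      then have "reach F x z \<longleftrightarrow> reach F y z" for z
        using reach_trans[of F x y z] reach_trans[of F y x z] reach_sym[of F x y] by blast
      then show "q x = q y"
        unfolding q_def by simp
    qed
    have q': "q' x = (if q x = q a \<or> q x = q b then q a \<union> q b else q x)" if "x \<in> S" for x
    proof -
      have "reach (Set.insert {a, b} F) x z \<longleftrightarrow>
          (if reach F x a \<or> reach F x b then reach F a z \<or> reach F b z else reach F x z)" for z
        unfolding reach_insert
        using reach_sym[of F] reach_trans[of F] by (metis (no_types))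
      then show ?thesis
        unfolding q_eq[OF that ab(1)] q_eq[OF that ab(2)]
        unfolding q_def q'_def ab(3) by auto
    qed
    have "q' ` S = Set.insert (q a \<union> q b) (q ` S - {q a, q b})"
      using ab(1,2) by (auto simp: q' image_iff)
    moreover have "q a \<union> q b \<notin> q ` S - {q a, q b}"
    proof
      assume "q a \<union> q b \<in> q ` S - {q a, q b}"
      then obtain x where x: "x \<in> S" "q a \<union> q b = q x" "q x \<noteq> q a"
        by auto
      have "a \<in> q a \<union> q b"
        using ab(1) by (simp add: q_def)
      then have "reach F x a"
        unfolding x(2) by (simp add: q_def)
      then show False
        using x(1,3) q_eq[of x a] ab(1) by simp
    qed
    moreover have "card (q ` S - {q a, q b}) + 2 = card (q ` S)"
    proof -
      have "q a \<noteq> q b"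
        using q_eq[of a b] ab nab by simp
      then have "card {q a, q b} = 2"
        by simp
      moreover have "{q a, q b} \<subseteq> q ` S"
        using ab by auto
      ultimately show ?thesis
        using assms(1) card_mono[of "q ` S" "{q a, q b}"] by (simp add: card_Diff_subset)
    qed
    ultimately have "card (q' ` S) + 1 = card (q ` S)"
      using assms(1) by simp
    moreover have "card F + card (q ` S) = card S"
      using insert.IH insert.prems forest_subset[of _ F] unfolding q_def by blast
    ultimately show ?case
      using insert.hyps unfolding q'_def by simp
  qed
  with \<open>finite F\<close> show ?thesis
    by simp
qed

lemma forest_card_less:
  assumes "finite S" "S \<noteq> {}" "forest F" "\<And>e. e \<in> F \<Longrightarrow> \<exists>x\<in>S. \<exists>y\<in>S. e = {x, y}"
  shows "card F < card S"
proof -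
  have "card ((\<lambda>x. {y \<in> S. reach F x y}) ` S) > 0"
    using assms(1,2) by (simp add: card_gt_0_iff)
  then show ?thesis
    using forest_card[OF assms(1,3,4)] by linarith
qed

lemma tree_card:
  assumes "finite S" "S \<noteq> {}" "forest F" "\<And>e. e \<in> F \<Longrightarrow> \<exists>x\<in>S. \<exists>y\<in>S. e = {x, y}"
    and "\<And>x y. x \<in> S \<Longrightarrow> y \<in> S \<Longrightarrow> reach F x y"
  shows "card F + 1 = card S"
proof -
  have "(\<lambda>x. {y \<in> S. reach F x y}) ` S = {S}"
    using assms(2,5) by auto
  then show ?thesis
    using forest_card[OF assms(1,3,4)] by simp
qed

subsection \<open>Joining cycles\<close>

text \<open>Here \<open>q\<close> is \<open>p\<close> composed with the transposition of \<open>a\<close> and \<open>b\<close>.\<close>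

lemma funpow_transpose:
  assumes "b \<in> orbit p b" "a \<notin> orbit p b"
    and "q a = p b" "\<And>x. x \<noteq> a \<Longrightarrow> x \<noteq> b \<Longrightarrow> q x = p x"
    and "1 \<le> m" "m \<le> funpow_dist1 p b b"
  shows "(q ^^ m) a = (p ^^ m) b"
  using assms(5,6)
proof (induction m rule: dec_induct)
  case base
  then show ?case
    using assms(3) by simp
next
  case (step m)
  \<comment> \<open>Before its first return the \<open>p\<close>-orbit of \<open>b\<close> avoids
    \<open>b\<close>, and it never meets \<open>a\<close>, so \<open>q\<close> acts like
    \<open>p\<close> on it.\<close>
  have "(p ^^ m) b \<noteq> b"
    using step funpow_dist1_least[of m p b b] by linarith
  moreover have "(p ^^ m) b \<noteq> a"
    using assms(1,2) funpow_in_orbit by metis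
  ultimately show ?case
    using step assms(4) by simp
qed

lemma orbit_funpow_image:
  assumes "b \<in> orbit p b"
  shows "orbit p b = (\<lambda>m. (p ^^ m) b) ` {1..funpow_dist1 p b b}"
proof
  show "orbit p b \<subseteq> (\<lambda>m. (p ^^ m) b) ` {1..funpow_dist1 p b b}"
  proof
    fix x
    assume "x \<in> orbit p b"
    then obtain k where k: "x = (p ^^ k) b" "k < funpow_dist1 p b b"
      unfolding orbit_conv_funpow_dist1[OF assms] by auto
    show "x \<in> (\<lambda>m. (p ^^ m) b) ` {1..funpow_dist1 p b b}"
    proof (cases "k = 0")
      case True
      then have "x = (p ^^ funpow_dist1 p b b) b"
        using funpow_dist1_prop[OF assms] k by simp
      then show ?thesis
        by (rule image_eqI) simp
    next
      case False
      then show ?thesis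
        using k by auto
    qed
  qed
next
  show "(\<lambda>m. (p ^^ m) b) ` {1..funpow_dist1 p b b} \<subseteq> orbit p b"
    using assms by (auto intro: funpow_in_orbit)
qed

text \<open>From \<open>a\<close>, the map \<open>q\<close> first runs through the
  \<open>p\<close>-cycle of \<open>b\<close>, arriving at \<open>b\<close> itself; from there it
  runs through the \<open>p\<close>-cycle of \<open>a\<close>.\<close>

lemma orbit_join:
  assumes a: "a \<in> orbit p a" and b: "b \<in> orbit p b" and ab: "a \<notin> orbit p b"
    and qa: "q a = p b" and qb: "q b = p a" and q: "\<And>x. x \<noteq> a \<Longrightarrow> x \<noteq> b \<Longrightarrow> q x = p x"
  shows "orbit q a = orbit p a \<union> orbit p b"
proof
  have ba: "b \<notin> orbit p a"
    using a b ab by (metis orbit_cyclic_eq3 cyclic_on_def)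
  have pa: "p x \<in> orbit p a" if "x \<in> orbit p a" for x
    using that by (rule orbit.step)
  have pb: "p x \<in> orbit p b" if "x \<in> orbit p b" for x
    using that by (rule orbit.step)
  show "orbit q a \<subseteq> orbit p a \<union> orbit p b"
  proof
    fix x
    assume "x \<in> orbit q a"
    then show "x \<in> orbit p a \<union> orbit p b"
    proof induction
      case base
      then show ?case
        using qa by (auto intro: orbit.base)
    next
      case (step y)
      then show ?case
        using qa qb q[of y] pa pb by (cases "y = a"; cases "y = b") (auto intro: orbit.base)
    qed
  qed
  define s where "s = funpow_dist1 p b b"
  define s' where "s' = funpow_dist1 p a a"
  have m: "(q ^^ m) a = (p ^^ m) b" if "1 \<le> m" "m \<le> s" for m
    using funpow_transpose[where q = q, OF b ab qa] q that unfolding s_def by blast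
  have m': "(q ^^ m) b = (p ^^ m) a" if "1 \<le> m" "m \<le> s'" for m
    using funpow_transpose[where q = q, OF a ba qb] q that unfolding s'_def by blast
  have "(q ^^ s) a = b"
    using m[of s] funpow_dist1_prop[OF b] by (simp add: s_def)
  then have qmb: "(q ^^ (m + s)) a = (q ^^ m) b" for m
    by (simp add: funpow_add)
  have orb: "(q ^^ k) a \<in> orbit q a" if "k \<ge> 1" for k
    using that by (induction k rule: dec_induct) (auto intro: orbit.intros)
  show "orbit p a \<union> orbit p b \<subseteq> orbit q a"
  proof
    fix x
    assume "x \<in> orbit p a \<union> orbit p b"
    then consider k where "1 \<le> k" "k \<le> s'" "x = (p ^^ k) a" | k where "1 \<le> k" "k \<le> s" "x = (p ^^ k) b"
      unfolding orbit_funpow_image[OF a] orbit_funpow_image[OF b] s_def s'_def by auto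
    then show "x \<in> orbit q a"
    proof cases
      case 1
      then have "x = (q ^^ (k + s)) a"
        using m' qmb by simp
      then show ?thesis
        using orb 1 by simp
    next
      case 2
      then show ?thesis
        using m orb by metis
    qed
  qed
qed

subsection \<open>Tours of spanning trees\<close>

declare tour_step.simps [simp del]

lemma succ_in_next: "{x, \<sigma> x y} \<in> G \<Longrightarrow> succ_in \<sigma> G x y = \<sigma> x y"
proof -
  assume "{x, \<sigma> x y} \<in> G"
  then have "(LEAST k. k \<ge> 1 \<and> {x, (\<sigma> x ^^ k) y} \<in> G) = 1"
    by (intro Least_equality) auto
  then show ?thesis
    by (simp add: succ_in_def)
qed

text \<open>The colours become an ordered pair of classes, cut class first, so that both choices of
  cut class are instances.\<close>

locale bipartite_ribbon =
  fixes C D :: "'n set" and B :: "'n set set" and \<sigma> :: "'n \<Rightarrow> 'n \<Rightarrow> 'n" and b0 b1 :: 'n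
  assumes finite_C: "finite C" and finite_D: "finite D" and disjoint: "C \<inter> D = {}"
    and edge_ex: "e \<in> B \<Longrightarrow> \<exists>c\<in>C. \<exists>d\<in>D. e = {c, d}"
    and connected: "connected_graph (C \<union> D) B"
    and ribbon: "ribbon_structure (C \<union> D) B \<sigma>"
    and base: "{b0, b1} \<in> B"
begin

abbreviation "N \<equiv> C \<union> D"

definition darts :: "('n \<times> 'n) set" where
  "darts = {(x, y). {x, y} \<in> B}"

lemma edge_cases: "{x, y} \<in> B \<Longrightarrow> x \<in> C \<and> y \<in> D \<or> x \<in> D \<and> y \<in> C"
  using edge_ex[of "{x, y}"] by (auto simp: doubleton_eq_iff)

lemma edge_neq: "{x, y} \<in> B \<Longrightarrow> x \<noteq> y"
  using edge_cases disjoint by blast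

lemma no_loop: "{x} \<notin> B"
  using edge_neq[of x x] by auto

lemma edge_nodes: "{x, y} \<in> B \<Longrightarrow> x \<in> N \<and> y \<in> N"
  using edge_cases by blast

lemma finite_B: "finite B"
proof (rule finite_subset)
  show "B \<subseteq> Pow N"
    using edge_ex by blast
qed (simp add: finite_C finite_D)

lemma orbit_ribbon: "{x, y} \<in> B \<Longrightarrow> orbit (\<sigma> x) y = {z. {x, z} \<in> B}"
  using ribbon edge_nodes unfolding ribbon_structure_def
  by (intro orbit_cyclic_eq3) auto

lemma ribbon_edge: "{x, y} \<in> B \<Longrightarrow> {x, \<sigma> x y} \<in> B"
  using orbit_ribbon[of x y] orbit.base[of "\<sigma> x" y] by blast

lemma spanning_tree_iff:
  assumes "G \<subseteq> B"
  shows "spanning_tree N G T \<longleftrightarrow> T \<subseteq> G \<and> connected_graph N T \<and> forest T"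
proof (cases "T \<subseteq> G")
  case True
  then have "(\<nexists>p. is_cycle T p) \<longleftrightarrow> forest T"
    using assms no_loop by (intro acyclic_iff_forest) blast
  then show ?thesis
    by (simp add: spanning_tree_def)
qed (simp add: spanning_tree_def)

text \<open>Induction over the edges: with none, the step only rotates about \<open>x\<close>; each
  new edge joins two cycles by \<open>orbit_join\<close>. Arbitrary forests are allowed for the sake
  of the induction and because \<open>tour_interval\<close> deletes an edge from a tree.\<close>

lemma orbit_tour_step:
  assumes "forest T" "T \<subseteq> B" "{x, y} \<in> B"
  shows "orbit (tour_step \<sigma> T) (x, y) = {(u, w). {u, w} \<in> B \<and> reach T x u}"
proof -
  have "finite T"
    using assms(2) finite_B finite_subset by blast
  then show ?thesis
    using assms
  proof (induction T arbitrary: x y rule: finite_induct)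
    case empty
    have "tour_step \<sigma> {} = (\<lambda>(x, y). (x, \<sigma> x y))"
      by (auto simp: tour_step.simps)
    then have "(tour_step \<sigma> {} ^^ k) (x, y) = (x, (\<sigma> x ^^ k) y)" for k
      by (induction k) auto
    then have "orbit (tour_step \<sigma> {}) (x, y) = {x} \<times> orbit (\<sigma> x) y"
      by (auto simp: orbit_altdef)
    then show ?case
      by (auto simp: orbit_ribbon[OF empty.prems(3)])
  next
    case (insert e T)
    obtain c d where e: "e = {c, d}"
      using edge_ex insert.prems(2) by blast
    let ?T = "Set.insert {c, d} T"
    let ?p = "tour_step \<sigma> T" and ?q = "tour_step \<sigma> ?T"
    have B: "{c, d} \<in> B" "{d, c} \<in> B" "T \<subseteq> B"
      using insert.prems(2) e by (auto simp: insert_commute)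
    have nT: "{c, d} \<notin> T" "{d, c} \<notin> T"
      using insert.hyps(2) e by (auto simp: insert_commute)
    have F: "forest T"
      using insert.prems(1) by (rule forest_subset) auto
    have orb: "orbit ?p (x, y) = {(u, w). {u, w} \<in> B \<and> reach T x u}" if "{x, y} \<in> B" for x y
      using insert.IH F B(3) that by simp
    have ncd: "\<not> reach T c d" "\<not> reach T d c"
      using forest_insertD[of c d T] insert.prems(1) nT(1) e reach_sym[of T] by auto
    have neq: "?q z = ?p z" if "z \<noteq> (c, d)" "z \<noteq> (d, c)" for z
      using that by (cases z) (auto simp: tour_step.simps doubleton_eq_iff)
    have "orbit ?q (c, d) = orbit ?p (c, d) \<union> orbit ?p (d, c)"
    proof (rule orbit_join)
      show "(c, d) \<in> orbit ?p (c, d)" "(d, c) \<in> orbit ?p (d, c)" "(c, d) \<notin> orbit ?p (d, c)"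
        using B ncd by (simp_all add: orb)
      \<comment> \<open>Without \<open>cd\<close>, both its half-edges rotate about their own node;
        once it is added, each crosses first and so gets the other's former successor.\<close>
      show "?q (c, d) = ?p (d, c)" "?q (d, c) = ?p (c, d)"
        using nT by (simp_all add: tour_step.simps insert_commute)
    qed (rule neq)
    then have joined: "orbit ?q (c, d) = {(u, w). {u, w} \<in> B \<and> (reach T c u \<or> reach T d u)}"
      using B by (auto simp: orb)
    have "orbit ?q (x, y) = {(u, w). {u, w} \<in> B \<and> reach ?T x u}"
    proof (cases "reach T c x \<or> reach T d x")
      case True
      then have "(x, y) \<in> orbit ?q (c, d)"
        using insert.prems(3) joined by simp
      moreover have "cyclic_on ?q (orbit ?q (c, d))"
        using joined B(1) by (intro cyclic_on_singleI[of "(c, d)"]) simp_all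
      ultimately have "orbit ?q (x, y) = orbit ?q (c, d)"
        by (intro orbit_cyclic_eq3)
      moreover have "reach ?T x u \<longleftrightarrow> reach T c u \<or> reach T d u" for u
        using True reach_sym[of T] reach_trans[of T] unfolding reach_insert by (metis (no_types))
      ultimately show ?thesis
        using joined by simp
    next
      case False
      then have n: "\<not> reach T x c" "\<not> reach T x d"
        using reach_sym by metis+
      have "orbit ?q (x, y) = orbit ?p (x, y)"
      proof (rule orbit_cong)
        show "(x, y) \<in> orbit ?p (x, y)"
          using orb insert.prems(3) by simp
        show "?q z = ?p z" if "z \<in> orbit ?p (x, y)" for z
          using that n insert.prems(3) by (intro neq) (auto simp: orb)
      qed
      then show ?thesis
        using orb insert.prems(3) n by (simp add: reach_insert)
    qed
    then show ?case
      using e by simp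
  qed
qed

section \<open>The tour as a periodic sequence of half-edges\<close>

definition tour_at :: "'n set set \<Rightarrow> nat \<Rightarrow> 'n \<times> 'n" where
  "tour_at T k = (tour_step \<sigma> T ^^ k) (b0, b1)"

lemma tour_at_0 [simp]: "tour_at T 0 = (b0, b1)"
  by (simp add: tour_at_def)

lemma tour_at_Suc: "tour_at T (Suc k) = tour_step \<sigma> T (tour_at T k)"
  by (simp add: tour_at_def)

lemma tour_at_add: "tour_at T (k + m) = (tour_step \<sigma> T ^^ m) (tour_at T k)"
  by (simp add: tour_at_def add.commute[of k] funpow_add)

lemma tour_at_edge: "tour_at T k = (x, y) \<Longrightarrow> {x, y} \<in> B"
proof (induction k arbitrary: x y)
  case 0
  then show ?case
    using base by simp
next
  case (Suc k)
  obtain u w where uw: "tour_at T k = (u, w)"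
    by force
  then have "{u, w} \<in> B" "{w, u} \<in> B"
    using Suc.IH by (auto simp: insert_commute)
  then show ?case
    using Suc.prems uw ribbon_edge by (auto simp: tour_at_Suc tour_step.simps split: if_splits)
qed

text \<open>The common length of the tours of all spanning trees.\<close>

abbreviation "n \<equiv> card darts"

context
  fixes T
  assumes T: "spanning_tree N B T"
begin

lemma T_subset: "T \<subseteq> B" and T_forest: "forest T" and T_connected: "connected_graph N T"
  using T spanning_tree_iff by auto

lemma T_reach: "x \<in> N \<Longrightarrow> y \<in> N \<Longrightarrow> reach T x y"
  using T_connected by (simp add: connected_graph_reach)

lemma orbit_base: "orbit (tour_step \<sigma> T) (b0, b1) = darts"
  using orbit_tour_step[OF T_forest T_subset base] T_reach edge_nodes base
  unfolding darts_def by blast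

lemma base_in_orbit: "(b0, b1) \<in> orbit (tour_step \<sigma> T) (b0, b1)"
  using base by (simp add: orbit_base darts_def)

text \<open>The first return time is the size of the cycle, and by \<open>orbit_base\<close> that
  cycle contains every half-edge.\<close>

lemma tour_length: "funpow_dist1 (tour_step \<sigma> T) (b0, b1) (b0, b1) = n"
  using card_image[OF inj_on_funpow_dist1[OF base_in_orbit]]
    orbit_conv_funpow_dist1[OF base_in_orbit] orbit_base
  by simp

lemma tour_at_bij: "bij_betw (tour_at T) {0..<n} darts"
  using inj_on_funpow_dist1[OF base_in_orbit] orbit_conv_funpow_dist1[OF base_in_orbit]
  unfolding bij_betw_def tour_length orbit_base tour_at_def by auto

lemma tour_at_inj: "i < n \<Longrightarrow> j < n \<Longrightarrow> tour_at T i = tour_at T j \<Longrightarrow> i = j"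
  using tour_at_bij unfolding bij_betw_def inj_on_def by simp

lemma tour_at_ex:
  assumes "{x, y} \<in> B"
  obtains i where "i < n" "tour_at T i = (x, y)"
proof -
  have "(x, y) \<in> tour_at T ` {0..<n}"
    using assms tour_at_bij by (simp add: bij_betw_def darts_def)
  then show thesis
    using that by auto
qed

lemma tour_at_period: "tour_at T (k + n) = tour_at T k"
proof -
  have "tour_at T n = (b0, b1)"
    using funpow_dist1_prop[OF base_in_orbit] unfolding tour_length tour_at_def .
  then show ?thesis
    unfolding add.commute[of k] tour_at_add by (simp add: tour_at_def)
qed

lemma tour_conv: "tour \<sigma> b0 b1 T = map (tour_at T) [0..<n]"
proof -
  have "(LEAST k. k \<ge> 1 \<and> (tour_step \<sigma> T ^^ k) (b0, b1) = (b0, b1)) = n"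
  proof (rule Least_equality)
    have "n \<ge> 1"
      using tour_length by linarith
    then show "1 \<le> n \<and> (tour_step \<sigma> T ^^ n) (b0, b1) = (b0, b1)"
      using tour_at_period[of 0] by (simp add: tour_at_def)
    show "n \<le> k" if "1 \<le> k \<and> (tour_step \<sigma> T ^^ k) (b0, b1) = (b0, b1)" for k
      using funpow_dist1_least[of k "tour_step \<sigma> T" "(b0, b1)" "(b0, b1)"] that tour_length
      by force
  qed
  then show ?thesis
    by (simp add: tour_def tour_at_def)
qed

lemma cut_at_iff:
  "cut_at \<sigma> b0 b1 T x y \<longleftrightarrow> (\<exists>i j. i < j \<and> j < n \<and> tour_at T i = (x, y) \<and> tour_at T j = (y, x))"
  unfolding cut_at_def tour_conv by (intro iff_exI) auto

text \<open>Right after \<open>i\<close> the tour of \<open>T\<close> behaves like that of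
  \<open>T - {{x, y}}\<close> started at \<open>(y, x)\<close>, whose orbit consists of the
  half-edges on the side of \<open>y\<close>. The interval is open at \<open>i\<close> and closed at
  \<open>j\<close> because the current node is still \<open>x\<close> at \<open>i\<close> but
  \<open>y\<close> at \<open>j\<close>.\<close>

lemma tour_interval:
  assumes xy: "{x, y} \<in> T" and i: "tour_at T i = (x, y)" and j: "tour_at T j = (y, x)" and "i < j" "j < n" "m < n"
  shows "i < m \<and> m \<le> j \<longleftrightarrow> reach (T - {{x, y}}) y (fst (tour_at T m))"
proof -
  let ?T = "T - {{x, y}}"
  let ?p = "tour_step \<sigma> ?T" and ?q = "tour_step \<sigma> T"
  have xyB: "{x, y} \<in> B" "{y, x} \<in> B"
    using xy T_subset by (auto simp: insert_commute)
  have F: "forest ?T"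
    using T_forest by (rule forest_subset) auto
  have orb: "orbit ?p (u, v) = {(a, b). {a, b} \<in> B \<and> reach ?T u a}" if "{u, v} \<in> B" for u v
    using that T_subset by (intro orbit_tour_step[OF F]) auto
  have nr: "\<not> reach ?T y x"
    using forestD[OF T_forest xy] reach_sym by metis
  have self: "(y, x) \<in> orbit ?p (y, x)"
    using xyB by (simp add: orb)
  define s where "s = funpow_dist1 ?p (y, x) (y, x)"
  have step: "tour_at T (i + m) = (?p ^^ m) (y, x)" if "1 \<le> m" "m \<le> s" for m
    unfolding tour_at_add i
  proof (rule funpow_transpose[OF self])
    show "(x, y) \<notin> orbit ?p (y, x)"
      using xyB nr by (simp add: orb)
    show "?q (x, y) = ?p (y, x)"
      using xy by (simp add: tour_step.simps insert_commute)
    show "?q z = ?p z" if "z \<noteq> (x, y)" "z \<noteq> (y, x)" for z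
      using that by (cases z) (auto simp: tour_step.simps doubleton_eq_iff)
  qed (use that s_def in auto)
  have "s \<ge> 1"
    by (simp add: s_def)
  have eq: "j = i + s"
  proof -
    \<comment> \<open>This bound puts \<open>i + s\<close> below \<open>n\<close>, where injectivity
      of the tour identifies it with \<open>j\<close>.\<close>
    have "\<not> j - i < s"
    proof
      assume l: "j - i < s"
      then have "(?p ^^ (j - i)) (y, x) = (y, x)"
        using step[of "j - i"] j \<open>i < j\<close> by simp
      then show False
        using funpow_dist1_least[of "j - i" ?p "(y, x)" "(y, x)"] l \<open>i < j\<close> s_def by simp
    qed
    then have "i + s < n"
      using \<open>i < j\<close> \<open>j < n\<close> by linarith
    moreover have "tour_at T (i + s) = tour_at T j"
      using step[of s] \<open>s \<ge> 1\<close> funpow_dist1_prop[OF self] j s_def by simp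
    ultimately show ?thesis
      using tour_at_inj \<open>j < n\<close> by metis
  qed
  have orb_tr: "orbit ?p (y, x) = (\<lambda>m. tour_at T (i + m)) ` {1..s}"
    unfolding orbit_funpow_image[OF self] s_def[symmetric] by (intro image_cong) (auto simp: step)
  obtain a b where ab: "tour_at T m = (a, b)"
    by force
  have "reach ?T y (fst (tour_at T m)) \<longleftrightarrow> tour_at T m \<in> orbit ?p (y, x)"
    using xyB tour_at_edge[OF ab] ab by (simp add: orb)
  also have "\<dots> \<longleftrightarrow> (\<exists>k\<in>{1..s}. m = i + k)"
  proof -
    have "tour_at T m = tour_at T (i + k) \<longleftrightarrow> m = i + k" if "k \<in> {1..s}" for k
      using tour_at_inj[OF \<open>m < n\<close>, of "i + k"] that eq \<open>j < n\<close> by auto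
    then show ?thesis
      unfolding orb_tr image_iff by (intro bex_cong) auto
  qed
  also have "\<dots> \<longleftrightarrow> i < m \<and> m \<le> j"
    using eq by (auto intro!: bexI[of _ "m - i"])
  finally show ?thesis
    by simp
qed

end

section \<open>Comparing degrees of spanning trees on one colour class\<close>

lemma sum_degree:
  assumes "X = C \<or> X = D" "G \<subseteq> B" "A \<subseteq> X"
  shows "(\<Sum>a\<in>A. degree G a) = card {e \<in> G. \<exists>a\<in>A. a \<in> e}"
proof -
  have "finite A" "finite G"
    using assms finite_C finite_D finite_B finite_subset by metis+
  \<comment> \<open>No edge has two ends in one colour class, so none is counted twice.\<close>
  moreover have "{e \<in> G. a \<in> e} \<inter> {e \<in> G. b \<in> e} = {}" if "a \<in> A" "b \<in> A" "a \<noteq> b" for a b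
    using that assms edge_ex disjoint by blast
  ultimately have "card (\<Union>a\<in>A. {e \<in> G. a \<in> e}) = (\<Sum>a\<in>A. card {e \<in> G. a \<in> e})"
    by (intro card_UN_disjoint) auto
  moreover have "(\<Union>a\<in>A. {e \<in> G. a \<in> e}) = {e \<in> G. \<exists>a\<in>A. a \<in> e}"
    by auto
  ultimately show ?thesis
    by (simp add: degree_def)
qed

text \<open>
  Among the edges of \<open>T\<close> meeting \<open>X \<inter> S\<close> there is one more than a forest can have inside \<open>S\<close>.
\<close>

lemma degree_differs:
  assumes X: "X = C \<or> X = D" and T: "spanning_tree N B T" and zw: "{z, w} \<in> T" and z: "z \<in> X"
    and T': "spanning_tree N B T'"
    and S: "S = {u \<in> N. reach (T - {{z, w}}) z u}"
    and inside: "\<And>a b. a \<in> X \<inter> S \<Longrightarrow> {a, b} \<in> T' \<Longrightarrow> b \<in> S"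
  shows "\<exists>a\<in>X. degree T a \<noteq> degree T' a"
proof (rule ccontr)
  assume "\<not> ?thesis"
  then have "(\<Sum>a\<in>X \<inter> S. degree T a) = (\<Sum>a\<in>X \<inter> S. degree T' a)"
    by (intro sum.cong) auto
  then have eq: "card {e \<in> T. \<exists>a\<in>X \<inter> S. a \<in> e} = card {e \<in> T'. \<exists>a\<in>X \<inter> S. a \<in> e}"
    using sum_degree[OF X] T_subset[OF T] T_subset[OF T'] by simp
  have T_X: "\<exists>a b. e = {a, b} \<and> a \<in> X" if "e \<in> B" for e
    using edge_ex[OF that] X by (auto simp: insert_commute)
  have zN: "z \<in> N"
    using z X by auto
  have S_fin: "finite S" "S \<noteq> {}"
    using S zN finite_C finite_D by auto
  have nr: "\<not> reach (T - {{z, w}}) z w"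
    using forestD[OF T_forest[OF T] zw] .
  let ?F = "{e \<in> T - {{z, w}}. e \<subseteq> S}"
  have T_edges: "b \<in> S" if "a \<in> S" "{a, b} \<in> T - {{z, w}}" for a b
  proof -
    have "reach (T - {{z, w}}) z b"
      using that reach_edge[OF that(2)] S by (auto intro: reach_trans)
    moreover have "b \<in> N"
      using that T_subset[OF T] edge_nodes by blast
    ultimately show ?thesis
      using S by simp
  qed
  have in_S: "\<exists>x\<in>S. \<exists>y\<in>S. e = {x, y}" if "e \<in> B" "e \<subseteq> S" for e
    using edge_ex[OF that(1)] that(2) by blast
  \<comment> \<open>The component of \<open>z\<close> in \<open>T\<close> without \<open>zw\<close>
    is a tree with node set \<open>S\<close>.\<close>
  have "card ?F + 1 = card S"
  proof (rule tree_card[OF S_fin])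
    show "forest ?F"
      using T_forest[OF T] by (rule forest_subset) auto
    show "\<exists>x\<in>S. \<exists>y\<in>S. e = {x, y}" if "e \<in> ?F" for e
      using that in_S T_subset[OF T] by auto
    have from_z: "reach ?F z u" if "u \<in> S" for u
    proof -
      have "reach (T - {{z, w}}) z u"
        using that S by simp
      then have "u \<in> S \<and> reach ?F z u"
      proof (induction rule: reach_induct)
        case refl
        then show ?case
          using zN S by simp
      next
        case (step a b)
        then have "b \<in> S"
          using T_edges[of a b] by blast
        then have "{a, b} \<in> ?F"
          using step by simp
        then show ?case
          using step.IH \<open>b \<in> S\<close> reach_edge[of a b ?F] reach_trans[of ?F z a b] by blast
      qed
      then show ?thesis ..
    qed
    show "reach ?F x y" if "x \<in> S" "y \<in> S" for x y
      using from_z[OF that(1)] from_z[OF that(2)] reach_sym[of ?F] reach_trans[of ?F] by blast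
  qed
  \<comment> \<open>Every edge inside \<open>S\<close> has an end in \<open>X\<close>; the edge
    \<open>zw\<close> leaves \<open>S\<close> but is counted at \<open>z\<close>. It is the surplus
    edge.\<close>
  moreover have "{e \<in> T. \<exists>a\<in>X \<inter> S. a \<in> e} = Set.insert {z, w} ?F"
  proof (intro set_eqI iffI)
    fix e
    assume "e \<in> {e \<in> T. \<exists>a\<in>X \<inter> S. a \<in> e}"
    then obtain a where a: "e \<in> T" "a \<in> S" "a \<in> e"
      by blast
    then obtain b where e: "e = {a, b}"
      using T_subset[OF T] edge_ex[of e] by (auto simp: insert_commute)
    show "e \<in> Set.insert {z, w} ?F"
      using T_edges[of a b] a e by auto
  next
    fix e
    assume e: "e \<in> Set.insert {z, w} ?F"
    then have "e \<in> T"
      using zw by auto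
    show "e \<in> {e \<in> T. \<exists>a\<in>X \<inter> S. a \<in> e}"
    proof (cases "e = {z, w}")
      case True
      then show ?thesis
        using zw z zN S by auto
    next
      case False
      then show ?thesis
        using e \<open>e \<in> T\<close> T_X[of e] T_subset[OF T] by auto
    qed
  qed
  moreover have "finite ?F"
    using T_subset[OF T] finite_B finite_subset by fastforce
  ultimately have "card {e \<in> T. \<exists>a\<in>X \<inter> S. a \<in> e} = card S"
    by simp
  \<comment> \<open>By \<open>inside\<close>, these edges of \<open>T'\<close> form a forest within
    \<open>S\<close>, so they are fewer than \<open>card S\<close>.\<close>
  moreover have "{e \<in> T'. \<exists>a\<in>X \<inter> S. a \<in> e} \<subseteq> {e \<in> T'. e \<subseteq> S}"
  proof
    fix e
    assume "e \<in> {e \<in> T'. \<exists>a\<in>X \<inter> S. a \<in> e}"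
    then obtain a where a: "e \<in> T'" "a \<in> X \<inter> S" "a \<in> e"
      by blast
    then obtain b where e: "e = {a, b}"
      using T_subset[OF T'] edge_ex[of e] by (auto simp: insert_commute)
    show "e \<in> {e \<in> T'. e \<subseteq> S}"
      using inside[of a b] a e by auto
  qed
  then have "card {e \<in> T'. \<exists>a\<in>X \<inter> S. a \<in> e} \<le> card {e \<in> T'. e \<subseteq> S}"
    using T_subset[OF T'] finite_B finite_subset by (intro card_mono) fastforce+
  moreover have "card {e \<in> T'. e \<subseteq> S} < card S"
  proof (rule forest_card_less[OF S_fin])
    show "forest {e \<in> T'. e \<subseteq> S}"
      using T_forest[OF T'] by (rule forest_subset) auto
    show "\<exists>x\<in>S. \<exists>y\<in>S. e = {x, y}" if "e \<in> {e \<in> T'. e \<subseteq> S}" for e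
      using that in_S T_subset[OF T'] by auto
  qed
  ultimately show False
    using eq by linarith
qed

subsection \<open>Existence of Jaeger trees\<close>

lemma spanning_tree_edge:
  assumes T: "spanning_tree N B T" and "x \<in> N"
  obtains z where "{x, z} \<in> T"
proof -
  obtain y where "y \<in> N" "y \<noteq> x"
    using base edge_nodes edge_neq by metis
  then show thesis
    using reach_first_edge[of T x y] T_reach[OF T \<open>x \<in> N\<close>] that by metis
qed

lemma degree_replace:
  assumes "finite T" "e \<in> T" "e' \<notin> T" "a \<in> e \<longleftrightarrow> a \<in> e'"
  shows "degree (insert e' (T - {e})) a = degree T a"
proof (cases "a \<in> e")
  case True
  then have "{u \<in> insert e' (T - {e}). a \<in> u} = insert e' ({u \<in> T. a \<in> u} - {e})"
    using assms(4) by auto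
  moreover have "card ({u \<in> T. a \<in> u} - {e}) + 1 = card {u \<in> T. a \<in> u}"
    using assms(1,2) True card_Suc_Diff1[of "{u \<in> T. a \<in> u}" e] by simp
  ultimately show ?thesis
    using assms by (simp add: degree_def)
next
  case False
  then have "{u \<in> insert e' (T - {e}). a \<in> u} = {u \<in> T. a \<in> u}"
    using assms(4) by auto
  then show ?thesis
    by (simp add: degree_def)
qed

text \<open>The edge \<open>cd\<close> is taken from the fundamental cycle of \<open>xy\<close> so
  that it shares with \<open>xy\<close> the end in \<open>X\<close>; the degrees that change are
  then outside \<open>X\<close>. The \<open>reach\<close> facts record which side of the deleted
  edge contains \<open>x\<close> and which contains \<open>y\<close>.\<close>

lemma exchange:
  assumes X: "X = C \<or> X = D" and T: "spanning_tree N B T"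
    and x: "x \<in> C" and y: "y \<in> D" and xy: "{x, y} \<in> B - T"
  obtains c d where "c \<in> C" "d \<in> D" "{c, d} \<in> T"
    "reach (T - {{c, d}}) c x" "reach (T - {{c, d}}) d y"
    "spanning_tree N B (insert {x, y} (T - {{c, d}}))"
    "\<And>a. a \<in> X \<Longrightarrow> degree (insert {x, y} (T - {{c, d}})) a = degree T a"
proof -
  have TB: "T \<subseteq> B"
    using T_subset[OF T] .
  have "x \<noteq> y"
    using x y disjoint by blast
  have nodes: "x \<in> N" "y \<in> N"
    using x y by auto
  obtain c d where cd: "c \<in> C" "d \<in> D" "{c, d} \<in> T"
    "reach (T - {{c, d}}) c x" "reach (T - {{c, d}}) d y"
    and X': "X = C \<and> c = x \<or> X = D \<and> d = y"
  proof (cases "X = D")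
    case True
    obtain z where z: "{y, z} \<in> T" "reach (T - {{y, z}}) z x"
      using reach_first_edge[OF T_reach[OF T nodes(2,1)]] \<open>x \<noteq> y\<close> by metis
    moreover have "z \<in> C"
      using z TB y edge_cases disjoint by blast
    ultimately show thesis
      using that[of z y] True y by (simp add: insert_commute)
  next
    case False
    obtain z where z: "{x, z} \<in> T" "reach (T - {{x, z}}) z y"
      using reach_first_edge[OF T_reach[OF T nodes]] \<open>x \<noteq> y\<close> by metis
    moreover have "z \<in> D"
      using z TB x edge_cases disjoint by blast
    ultimately show thesis
      using that[of x z] False X x by simp
  qed
  let ?R = "T - {{c, d}}"
  let ?T = "insert {x, y} ?R"
  have ncd: "\<not> reach ?R c d"
    using forestD[OF T_forest[OF T] cd(3)] .
  have "forest ?T"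
  proof (rule forest_insert)
    show "forest ?R"
      using T_forest[OF T] by (rule forest_subset) auto
    show "\<not> reach ?R x y"
      using ncd cd(4,5) by (meson reach_sym reach_trans)
  qed
  moreover have "connected_graph N ?T"
    unfolding connected_graph_reach
  proof (intro ballI)
    fix u v
    assume "u \<in> N" "v \<in> N"
    then have "reach (insert {c, d} ?R) u v"
      using T_reach[OF T] cd(3) by (simp add: insert_absorb)
    then have "reach ?R u v \<or> (reach ?R u c \<and> reach ?R d v) \<or> (reach ?R u d \<and> reach ?R c v)"
      by (simp only: reach_insert)
    then show "reach ?T u v"
      unfolding reach_insert
      using cd(4,5) reach_sym[of ?R] reach_trans[of ?R] by (metis (no_types))
  qed
  moreover have "?T \<subseteq> B"
    using xy TB by auto
  ultimately have "spanning_tree N B ?T"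
    by (simp add: spanning_tree_iff)
  moreover have "degree ?T a = degree T a" if "a \<in> X" for a
  proof (rule degree_replace)
    show "finite T"
      using TB finite_B finite_subset by blast
    show "a \<in> {c, d} \<longleftrightarrow> a \<in> {x, y}"
      using that X' x y cd(1,2) disjoint by auto
  qed (use cd xy in auto)
  ultimately show thesis
    using that cd by blast
qed

text \<open>The lexicographically cheapest tree of given degrees on \<open>X\<close> turns out to be a Jaeger tree.\<close>

definition tour_cost :: "'n set set \<Rightarrow> nat list" where
  "tour_cost T = map (\<lambda>k. of_bool (fst (tour_at T k) \<in> C \<longleftrightarrow> {fst (tour_at T k), snd (tour_at T k)} \<in> T)) [0..<n]"

lemma tour_at_agree:
  assumes "\<And>i x y. i < k \<Longrightarrow> tour_at T i = (x, y) \<Longrightarrow> {x, y} \<in> T' \<longleftrightarrow> {x, y} \<in> T"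
  shows "tour_at T' k = tour_at T k"
  using assms
proof (induction k)
  case (Suc k)
  obtain x y where xy: "tour_at T k = (x, y)"
    by force
  have "tour_at T' k = tour_at T k"
    by (rule Suc.IH) (use Suc.prems less_SucI in blast)
  then show ?case
    using Suc.prems[OF _ xy] xy by (simp add: tour_at_Suc tour_step.simps)
qed simp

text \<open>A tour step depends only on whether the edge met is in the tree, so both tours coincide
  up to \<open>m\<close>. There \<open>T\<close> pays 1, for keeping an edge at \<open>C\<close> or
  passing it over outside \<open>C\<close>, and \<open>T'\<close> pays 0.\<close>

lemma tour_cost_less:
  assumes "m < n"
    and agree: "\<And>i x y. i < m \<Longrightarrow> tour_at T i = (x, y) \<Longrightarrow> {x, y} \<in> T' \<longleftrightarrow> {x, y} \<in> T"
    and m: "tour_at T m = (x, y)" and better: "{x, y} \<in> T \<longleftrightarrow> x \<in> C" "{x, y} \<in> T' \<longleftrightarrow> x \<notin> C"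
  shows "(tour_cost T', tour_cost T) \<in> lex less_than"
proof -
  have tr: "tour_at T' k = tour_at T k" if "k \<le> m" for k
    using that by (intro tour_at_agree agree) auto
  have "tour_cost T' ! k = tour_cost T ! k" if "k < m" for k
    using tr[of k] agree[OF that, of "fst (tour_at T k)" "snd (tour_at T k)"] that \<open>m < n\<close>
    by (simp add: tour_cost_def)
  then have "take m (tour_cost T') = take m (tour_cost T)"
    using \<open>m < n\<close> by (intro nth_equalityI) (auto simp: tour_cost_def)
  moreover have "tour_cost T' ! m < tour_cost T ! m"
    using \<open>m < n\<close> tr[of m] m better by (simp add: tour_cost_def)
  moreover have "m < min (length (tour_cost T')) (length (tour_cost T))"
    using \<open>m < n\<close> by (simp add: tour_cost_def)
  ultimately have "(tour_cost T', tour_cost T) \<in> lexord less_than"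
    unfolding lexord_take_index_conv by blast
  \<comment> \<open>Equal lengths allow \<open>lex\<close>, which is well-founded, in place of
    \<open>lexord\<close>.\<close>
  moreover have "length (tour_cost T') = length (tour_cost T)"
    by (simp add: tour_cost_def)
  ultimately show ?thesis
    by (simp add: lexord_lex)
qed

text \<open>Exchanging \<open>xy\<close> for \<open>cd\<close> affects only four half-edges. The
  first of them on the tour of \<open>T\<close> is \<open>(y, x)\<close> or \<open>(c, d)\<close>;
  at either one \<open>T\<close> pays and the new tree does not.\<close>

lemma better_tree:
  assumes X: "X = C \<or> X = D" and T: "spanning_tree N B T"
    and "x \<in> C" and xy: "{x, y} \<in> B - T" and uncut: "\<not> cut_at \<sigma> b0 b1 T x y"
  obtains T' where "spanning_tree N B T'" "\<And>a. a \<in> X \<Longrightarrow> degree T' a = degree T a"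
    "(tour_cost T', tour_cost T) \<in> lex less_than"
proof -
  have "y \<in> D"
    using xy \<open>x \<in> C\<close> edge_cases disjoint by blast
  then have "x \<noteq> y" "y \<notin> C"
    using \<open>x \<in> C\<close> disjoint by auto
  obtain i where i: "i < n" "tour_at T i = (y, x)"
    using tour_at_ex[OF T, of y x] xy by (auto simp: insert_commute)
  obtain j where j: "j < n" "tour_at T j = (x, y)"
    using tour_at_ex[OF T, of x y] xy by auto
  have "i < j"
    using uncut i j \<open>x \<noteq> y\<close> unfolding cut_at_iff[OF T] by (metis linorder_neqE_nat prod.inject)
  obtain c d where cd: "c \<in> C" "d \<in> D" "{c, d} \<in> T"
    "reach (T - {{c, d}}) c x" "reach (T - {{c, d}}) d y"
    and T': "spanning_tree N B (insert {x, y} (T - {{c, d}}))"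
    "\<And>a. a \<in> X \<Longrightarrow> degree (insert {x, y} (T - {{c, d}})) a = degree T a"
    using exchange[OF X T \<open>x \<in> C\<close> \<open>y \<in> D\<close> xy] by metis
  let ?T = "insert {x, y} (T - {{c, d}})"
  have cdB: "{c, d} \<in> B"
    using cd(3) T_subset[OF T] by blast
  obtain p where p: "p < n" "tour_at T p = (c, d)"
    using tour_at_ex[OF T cdB] by metis
  obtain q where q: "q < n" "tour_at T q = (d, c)"
    using tour_at_ex[OF T, of d c] cdB by (metis insert_commute)
  have neq: "{x, y} \<noteq> {c, d}"
    using xy cd(3) by auto
  \<comment> \<open>The first time at which an exchanged edge is met; \<open>(x, y)\<close> comes
    after \<open>(y, x)\<close> since \<open>i < j\<close>.\<close>
  define m where "m = min i (min p q)"
  have agree: "{u, v} \<in> ?T \<longleftrightarrow> {u, v} \<in> T" if "k < m" "tour_at T k = (u, v)" for k u v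
  proof -
    have lt: "k < i" "k < j" "k < p" "k < q"
      using that(1) \<open>i < j\<close> by (auto simp: m_def)
    have "tour_at T k \<noteq> tour_at T l" if "k < l" "l < n" for l
      using tour_at_inj[OF T, of k l] that by auto
    then have "(u, v) \<notin> {(x, y), (y, x), (c, d), (d, c)}"
      using that(2) lt i j p q by (metis empty_iff insert_iff)
    then have "{u, v} \<noteq> {x, y}" "{u, v} \<noteq> {c, d}"
      by (auto simp: doubleton_eq_iff)
    then show ?thesis
      by simp
  qed
  have "m = i \<or> m = p"
  proof (rule ccontr)
    assume "\<not> ?thesis"
    \<comment> \<open>If \<open>(d, c)\<close> came first, the times after \<open>q\<close> up to
      \<open>p\<close> would be those on the side of \<open>c\<close>. They include
      \<open>j\<close>, hence also \<open>i\<close>, which puts \<open>y\<close> on the wrong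
      side.\<close>
    then have "q < i" "q < p"
      unfolding m_def by auto
    have dc: "{d, c} \<in> T" "T - {{d, c}} = T - {{c, d}}"
      using cd(3) by (auto simp: insert_commute)
    note interval = tour_interval[OF T dc(1) q(2) p(2) \<open>q < p\<close> p(1), unfolded dc(2)]
    have "q < j \<and> j \<le> p"
      using interval[OF j(1)] cd(4) j(2) by simp
    then have "reach (T - {{c, d}}) c y"
      using interval[OF i(1)] i(2) \<open>q < i\<close> \<open>i < j\<close> by simp
    then have "reach (T - {{c, d}}) c d"
      using cd(5) by (meson reach_sym reach_trans)
    then show False
      using forestD[OF T_forest[OF T] cd(3)] by simp
  qed
  then have "(tour_cost ?T, tour_cost T) \<in> lex less_than"
  proof
    assume "m = i"
    then show ?thesis
      using i(1) agree i(2)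
      by (rule_tac tour_cost_less[of i]) (use \<open>y \<notin> C\<close> xy neq in \<open>auto simp: insert_commute\<close>)
  next
    assume "m = p"
    then show ?thesis
      using p(1) agree p(2)
      by (rule_tac tour_cost_less[of p]) (use cd(1,3) neq in auto)
  qed
  then show thesis
    using that T' by blast
qed

text \<open>Well-foundedness of \<open>lex less_than\<close> gives a tree of least cost among those
  realizing \<open>f\<close>; an edge not cut at \<open>C\<close> would contradict minimality
  through \<open>better_tree\<close>.\<close>

lemma hypertree_jaeger_tree:
  assumes X: "X = C \<or> X = D" and "hypertree N B X f"
  obtains T where "jaeger_tree N B \<sigma> b0 b1 C T" "\<And>x. x \<in> X \<Longrightarrow> degree T x = f x + 1"
proof -
  define Q where "Q = {T. spanning_tree N B T \<and> (\<forall>x\<in>X. degree T x = f x + 1)}"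
  have "Q \<noteq> {}"
    using assms(2) by (auto simp: hypertree_def Q_def)
  moreover have "wf (inv_image (lex less_than) tour_cost)"
    by auto
  ultimately obtain T where T: "T \<in> Q"
    and min: "\<And>T'. (tour_cost T', tour_cost T) \<in> lex less_than \<Longrightarrow> T' \<notin> Q"
    by (metis in_inv_image wfE_min')
  have "cut_at \<sigma> b0 b1 T x y" if xy: "x \<in> C" "{x, y} \<in> B - T" for x y
  proof (rule ccontr)
    assume u: "\<not> cut_at \<sigma> b0 b1 T x y"
    have "spanning_tree N B T"
      using T by (simp add: Q_def)
    then obtain T' where T': "spanning_tree N B T'" "\<And>a. a \<in> X \<Longrightarrow> degree T' a = degree T a"
      "(tour_cost T', tour_cost T) \<in> lex less_than"
      using better_tree[OF X _ xy u] by metis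
    then have "T' \<in> Q"
      using T by (simp add: Q_def)
    then show False
      using min T'(3) by blast
  qed
  then show thesis
    using that[of T] T by (simp add: Q_def jaeger_tree_def)
qed

subsection \<open>Simulating the process\<close>

lemma succ_in_steps:
  assumes "{x, y} \<in> B" "{x, z} \<in> G" "G \<subseteq> B"
  obtains r where "1 \<le> r" "succ_in \<sigma> G x y = (\<sigma> x ^^ r) y" "{x, (\<sigma> x ^^ r) y} \<in> G"
    "\<And>k. 1 \<le> k \<Longrightarrow> k < r \<Longrightarrow> {x, (\<sigma> x ^^ k) y} \<notin> G"
proof -
  let ?P = "\<lambda>k. k \<ge> 1 \<and> {x, (\<sigma> x ^^ k) y} \<in> G"
  have "z \<in> orbit (\<sigma> x) y"
    using assms orbit_ribbon by auto
  then obtain k where "0 < k" "z = (\<sigma> x ^^ k) y"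
    unfolding orbit_altdef by auto
  then have "?P k"
    using assms(2) by simp
  then have "?P (Least ?P)"
    by (rule LeastI)
  moreover have "{x, (\<sigma> x ^^ k) y} \<notin> G" if "1 \<le> k" "k < Least ?P" for k
    using not_less_Least[OF that(2)] that(1) by simp
  ultimately show thesis
    using that[of "Least ?P"] by (simp add: succ_in_def)
qed

text \<open>\<open>bernardi_step\<close> removes \<open>xy\<close> but looks up its successor in the
  old graph. As another edge remains at \<open>x\<close>, the rotation meets such an edge before
  coming back to \<open>xy\<close>.\<close>

lemma succ_in_delete:
  assumes "{x, y} \<in> B" "{x, z} \<in> G - {{x, y}}" "G \<subseteq> B"
  shows "succ_in \<sigma> G x y = succ_in \<sigma> (G - {{x, y}}) x y"
proof -
  obtain r where r: "1 \<le> r" "succ_in \<sigma> (G - {{x, y}}) x y = (\<sigma> x ^^ r) y"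
    "{x, (\<sigma> x ^^ r) y} \<in> G - {{x, y}}"
    "\<And>k. 1 \<le> k \<Longrightarrow> k < r \<Longrightarrow> {x, (\<sigma> x ^^ k) y} \<notin> G - {{x, y}}"
    using succ_in_steps[OF assms(1,2)] assms(3) by blast
  have "(LEAST k. k \<ge> 1 \<and> {x, (\<sigma> x ^^ k) y} \<in> G) = r"
  proof (rule Least_equality)
    show "1 \<le> r \<and> {x, (\<sigma> x ^^ r) y} \<in> G"
      using r by simp
    fix k
    assume k: "1 \<le> k \<and> {x, (\<sigma> x ^^ k) y} \<in> G"
    show "r \<le> k"
    proof (rule ccontr)
      assume "\<not> r \<le> k"
      \<comment> \<open>Only \<open>xy\<close> distinguishes the two graphs, so the rotation is back
        at \<open>y\<close> after \<open>k\<close> steps, and \<open>r - k\<close> steps would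
        already have sufficed.\<close>
      then have "(\<sigma> x ^^ k) y = y"
        using r(4)[of k] k by (auto simp: doubleton_eq_iff)
      then have "(\<sigma> x ^^ r) y = (\<sigma> x ^^ (r - k)) y"
        using \<open>\<not> r \<le> k\<close> funpow_add[of "r - k" k "\<sigma> x"] by simp
      moreover have "1 \<le> r - k" "r - k < r"
        using k \<open>\<not> r \<le> k\<close> by linarith+
      ultimately show False
        using r(3) r(4)[of "r - k"] by metis
    qed
  qed
  then show ?thesis
    using r(2) by (simp add: succ_in_def)
qed

text \<open>
  For a Jaeger tree \<open>T\<close>, these are the current graph and the traversals of the process once the
  first \<open>k\<close> steps of the tour of \<open>T\<close> have been simulated.
\<close>

definition remaining :: "'n set set \<Rightarrow> nat \<Rightarrow> 'n set set" where
  "remaining T k = {e \<in> B. \<forall>c\<in>C. \<forall>d. e = {c, d} \<longrightarrow> e \<in> T \<or> (c, d) \<notin> tour_at T ` {..<k}}"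

definition traversed :: "'n set set \<Rightarrow> nat \<Rightarrow> ('n \<times> 'n) set" where
  "traversed T k = {(x, y). {x, y} \<in> T \<and> (x, y) \<in> tour_at T ` {..<k}}"

lemma remaining_iff:
  assumes "c \<in> C" "{c, d} \<in> B"
  shows "{c, d} \<in> remaining T k \<longleftrightarrow> {c, d} \<in> T \<or> (c, d) \<notin> tour_at T ` {..<k}"
proof -
  have "d \<notin> C"
    using assms edge_cases disjoint by blast
  then show ?thesis
    using assms by (auto simp: remaining_def doubleton_eq_iff)
qed

lemma remaining_subset: "remaining T k \<subseteq> B"
  by (auto simp: remaining_def)

lemma tree_subset_remaining: "T \<subseteq> B \<Longrightarrow> T \<subseteq> remaining T k"
  by (auto simp: remaining_def)

lemma bridge_complement:
  assumes "spanning_tree N B T" "{x, y} \<in> T" "u \<in> N"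
  shows "reach (T - {{x, y}}) x u \<longleftrightarrow> \<not> reach (T - {{x, y}}) y u"
proof -
  let ?R = "T - {{x, y}}"
  have "x \<in> N"
    using assms(2) T_subset[OF assms(1)] edge_nodes by blast
  then have "reach (insert {x, y} ?R) x u"
    using T_reach[OF assms(1)] assms(2,3) by (simp add: insert_absorb)
  then have "reach ?R x u \<or> reach ?R y u"
    unfolding reach_insert by blast
  moreover have "\<not> (reach ?R x u \<and> reach ?R y u)"
    using forestD[OF T_forest[OF assms(1)] assms(2)] by (meson reach_sym reach_trans)
  ultimately show ?thesis
    by blast
qed

section \<open>The process follows the tour of a fixed Jaeger tree\<close>

context
  fixes T X and f :: "'n \<Rightarrow> nat"
  assumes X: "X = C \<or> X = D" and J: "jaeger_tree N B \<sigma> b0 b1 C T"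
    and deg: "\<And>x. x \<in> X \<Longrightarrow> degree T x = f x + 1"
begin

lemma jaeger_spanning: "spanning_tree N B T"
  using J by (simp add: jaeger_tree_def)

lemma jaeger_cut:
  assumes "x \<in> C" "{x, y} \<in> B" "{x, y} \<notin> T"
  obtains i j where "i < j" "j < n" "tour_at T i = (x, y)" "tour_at T j = (y, x)"
proof -
  have "cut_at \<sigma> b0 b1 T x y"
    using J assms by (simp add: jaeger_tree_def)
  then show thesis
    using that cut_at_iff[OF jaeger_spanning] by blast
qed

text \<open>An edge \<open>cd\<close> violating this would be a non-edge of \<open>T\<close> still
  present, hence met from \<open>c\<close> after time \<open>k\<close> and from \<open>d\<close>
  even later. By \<open>tour_interval\<close> this does not fit the times spent on the two
  sides.\<close>

lemma remaining_cut:
  assumes k: "k < n" "tour_at T k = (x, y)" and xy: "x \<in> C" "{x, y} \<in> T"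
    and cd: "c \<in> C" "{c, d} \<in> remaining T k - {{x, y}}"
    and d: "reach (T - {{x, y}}) y d"
  shows "reach (T - {{x, y}}) y c"
proof (rule ccontr)
  assume nc: "\<not> reach (T - {{x, y}}) y c"
  note T = jaeger_spanning
  have cdB: "{c, d} \<in> B"
    using cd(2) remaining_subset by auto
  have "{c, d} \<notin> T"
  proof
    assume "{c, d} \<in> T"
    then have "reach (T - {{x, y}}) d c"
      using cd(2) by (intro reach_edge) (simp add: insert_commute)
    then show False
      using nc d reach_trans by metis
  qed
  then obtain p q where pq: "p < q" "q < n" "tour_at T p = (c, d)" "tour_at T q = (d, c)"
    using jaeger_cut cd(1) cdB by metis
  have "\<not> p < k"
    using cd(2) remaining_iff[OF cd(1) cdB, of T k] \<open>{c, d} \<notin> T\<close> pq(3) by force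
  moreover have "p \<noteq> k"
    using pq(3) k(2) cd(2) by auto
  ultimately have "k < p"
    by simp
  have "{y, x} \<in> B"
    using xy(2) T_subset[OF T] by (auto simp: insert_commute)
  then obtain j where j: "j < n" "tour_at T j = (y, x)"
    using tour_at_ex[OF T] by metis
  have "x \<noteq> y"
    using xy(2) T_subset[OF T] edge_neq by blast
  then have "j \<noteq> k"
    using j k by auto
  then consider "k < j" | "j < k"
    by linarith
  then show False
  proof cases
    case 1
    \<comment> \<open>The times after \<open>k\<close> up to \<open>j\<close> are those on the side
      of \<open>y\<close>; \<open>q\<close> is among them and hence so is \<open>p\<close>.\<close>
    note interval = tour_interval[OF T xy(2) k(2) j(2) 1 j(1)]
    have "q \<le> j"
      using interval[OF pq(2)] pq(4) d by simp
    then show False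
      using interval[of p] pq \<open>k < p\<close> nc by simp
  next
    case 2
    \<comment> \<open>The times after \<open>j\<close> up to \<open>k\<close> are those on the side
      of \<open>x\<close>; \<open>p\<close> comes later, so \<open>c\<close> lies with
      \<open>y\<close>.\<close>
    have yx: "{y, x} \<in> T" "T - {{y, x}} = T - {{x, y}}"
      using xy(2) by (auto simp: insert_commute)
    have "\<not> reach (T - {{x, y}}) x c"
      using tour_interval[OF T yx(1) j(2) k(2) 2 k(1), of p] pq \<open>k < p\<close> by (simp add: yx(2))
    then show False
      using bridge_complement[OF T xy(2), of c] nc cd(1) by simp
  qed
qed

text \<open>A competing tree with the same degrees on \<open>X\<close> contradicts
  \<open>degree_differs\<close>, applied to the side of the end of \<open>xy\<close> in
  \<open>X\<close>: by \<open>remaining_cut\<close> no edge of the competitor leaves that side from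
  a node of \<open>X\<close>.\<close>

lemma not_removable:
  assumes k: "k < n" "tour_at T k = (x, y)" and xy: "x \<in> C" "{x, y} \<in> T"
  shows "\<not> hypertree N (remaining T k - {{x, y}}) X f"
proof
  note T = jaeger_spanning
  let ?G = "remaining T k - {{x, y}}"
  assume "hypertree N ?G X f"
  then obtain T' where T': "spanning_tree N ?G T'" and deg': "\<And>a. a \<in> X \<Longrightarrow> degree T' a = degree T a"
    using deg unfolding hypertree_def by auto
  have GB: "?G \<subseteq> B"
    using remaining_subset by blast
  then have T'B: "spanning_tree N B T'" and T'G: "T' \<subseteq> ?G"
    using T' by (auto simp: spanning_tree_iff)
  have "y \<in> D"
    using xy T_subset[OF T] edge_cases disjoint by blast
  note cut = remaining_cut[OF k xy]
  have yx: "{y, x} \<in> T" "T - {{y, x}} = T - {{x, y}}"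
    using xy(2) by (auto simp: insert_commute)
  show False
  proof (cases "X = D")
    case True
    have "\<exists>a\<in>X. degree T a \<noteq> degree T' a"
    proof (rule degree_differs[OF X T yx(1) _ T'B refl])
      show "y \<in> X"
        using \<open>y \<in> D\<close> True by simp
      fix a b
      assume a: "a \<in> X \<inter> {u \<in> N. reach (T - {{y, x}}) y u}" and ab: "{a, b} \<in> T'"
      have "{a, b} \<in> B"
        using ab T'G GB by blast
      then have "b \<in> C"
        using a True edge_cases disjoint by blast
      moreover have "{b, a} \<in> ?G"
        using ab T'G by (auto simp: insert_commute)
      ultimately show "b \<in> {u \<in> N. reach (T - {{y, x}}) y u}"
        using cut[of b a] a by (simp add: yx(2))
    qed
    then show False
      using deg' by auto
  next
    case False
    then have XC: "X = C"
      using X by simp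
    have "\<exists>a\<in>X. degree T a \<noteq> degree T' a"
    proof (rule degree_differs[OF X T xy(2) _ T'B refl])
      show "x \<in> X"
        using xy(1) XC by simp
      fix a b
      assume a: "a \<in> X \<inter> {u \<in> N. reach (T - {{x, y}}) x u}" and ab: "{a, b} \<in> T'"
      have "b \<in> N"
        using ab T'G GB edge_nodes by blast
      moreover have "\<not> reach (T - {{x, y}}) y a"
        using bridge_complement[OF T xy(2)] a by blast
      then have "\<not> reach (T - {{x, y}}) y b"
        using cut[of a b] a ab T'G XC by blast
      ultimately show "b \<in> {u \<in> N. reach (T - {{x, y}}) x u}"
        using bridge_complement[OF T xy(2)] by simp
    qed
    then show False
      using deg' by auto
  qed
qed

abbreviation run where
  "run \<equiv> while (\<lambda>s. \<not> bernardi_stops N \<sigma> X f s) (bernardi_step N \<sigma> X f)"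

text \<open>The one edge still inspected after the whole tour belongs to \<open>T\<close>: it is a
  bridge and was traversed from \<open>w\<close>, so the loop stops at once.\<close>

lemma run_final:
  assumes "w \<in> C" "{w, y} \<in> B"
  shows "fst (run (T, (w, succ_in \<sigma> T w y), traversed T n)) = T"
proof -
  note T = jaeger_spanning
  let ?z = "succ_in \<sigma> T w y"
  obtain v where "{w, v} \<in> T"
    using spanning_tree_edge[OF T] assms(1) by blast
  then have wz: "{w, ?z} \<in> T"
    using succ_in_steps[OF assms(2) _ T_subset[OF T]] by metis
  have "\<not> hypertree N (T - {{w, ?z}}) X f"
  proof
    assume "hypertree N (T - {{w, ?z}}) X f"
    then obtain T' where T': "T' \<subseteq> T - {{w, ?z}}" "connected_graph N T'"
      unfolding hypertree_def spanning_tree_def by blast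
    have "w \<in> N" "?z \<in> N"
      using edge_nodes wz T_subset[OF T] by blast+
    then have "reach T' w ?z"
      using T'(2) by (simp add: connected_graph_reach)
    then show False
      using T'(1) forestD[OF T_forest[OF T] wz] reach_mono by metis
  qed
  moreover have "(w, ?z) \<in> traversed T n"
  proof -
    obtain i where "i < n" "tour_at T i = (w, ?z)"
      using tour_at_ex[OF T] wz T_subset[OF T] by (metis subsetD)
    then have "(w, ?z) \<in> tour_at T ` {..<n}"
      by (metis imageI lessThan_iff)
    then show ?thesis
      using wz by (simp add: traversed_def)
  qed
  ultimately show ?thesis
    by (subst while_unfold) simp
qed

text \<open>A non-edge of \<open>T\<close> is removed when met from its end in \<open>C\<close>.
  This is applied at time \<open>n\<close>, and also when the tour ends during a rotation about a
  node of \<open>D\<close>.\<close>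

lemma remaining_all:
  assumes "\<And>c d j. c \<in> C \<Longrightarrow> {c, d} \<notin> T \<Longrightarrow> tour_at T j = (c, d) \<Longrightarrow> j < n \<Longrightarrow> j < k"
  shows "remaining T k = T"
proof
  show "T \<subseteq> remaining T k"
    using T_subset[OF jaeger_spanning] by (rule tree_subset_remaining)
  show "remaining T k \<subseteq> T"
  proof
    fix e
    assume e: "e \<in> remaining T k"
    then have "e \<in> B"
      using remaining_subset by blast
    then obtain c d where cd: "c \<in> C" "e = {c, d}"
      using edge_ex by blast
    obtain j where j: "j < n" "tour_at T j = (c, d)"
      using tour_at_ex[OF jaeger_spanning] \<open>e \<in> B\<close> cd(2) by metis
    show "e \<in> T"
    proof (rule ccontr)
      assume "e \<notin> T"
      then have "j < k"
        using assms cd j by blast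
      then have "(c, d) \<in> tour_at T ` {..<k}"
        using j(2) by (metis imageI lessThan_iff)
      then show False
        using e \<open>e \<notin> T\<close> \<open>e \<in> B\<close> cd remaining_iff by blast
    qed
  qed
qed

text \<open>Induction on the rest of the tour, looking only at times when it is at a node of
  \<open>C\<close>. A removal is one tour step. A traversal jumps over a rotation about
  \<open>y\<close>, since the process skips the missing edges that the tour passes one by
  one.\<close>

lemma run_tour:
  assumes "k < n" "tour_at T k = (x, y)" "x \<in> C"
  shows "fst (run (remaining T k, (x, y), traversed T k)) = T"
  using assms
proof (induction "n - k" arbitrary: k x y rule: less_induct)
  case less
  note T = jaeger_spanning
  note k = less.prems(1,2) and x = less.prems(3)
  let ?G = "remaining T k"
  have xyB: "{x, y} \<in> B" "{y, x} \<in> B"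
    using tour_at_edge[OF k(2)] by (auto simp: insert_commute)
  have y: "y \<in> D" "y \<notin> C"
    using x xyB edge_cases disjoint by blast+
  have inj: "i = j" if "i < n" "j < n" "tour_at T i = tour_at T j" for i j
    using that tour_at_inj[OF T] by blast
  \<comment> \<open>for \<open>l = n\<close> the tour is over, but the process inspects one more, already traversed, edge\<close>
  have continue: "fst (run (remaining T l, (w, succ_in \<sigma> (remaining T l) w v), traversed T l)) = T"
    if l: "k < l" "l \<le> n" "tour_at T l = (w, \<sigma> w v)" and w: "w \<in> C" "{w, v} \<in> B" for l w v
  proof (cases "l = n")
    case True
    have "remaining T n = T"
      by (rule remaining_all)
    then show ?thesis
      using run_final[OF w] True by simp
  next
    case False
    then have "l < n"
      using l by simp
    have "{w, \<sigma> w v} \<in> B"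
      using ribbon_edge[OF w(2)] .
    moreover have "(w, \<sigma> w v) \<notin> tour_at T ` {..<l}"
    proof
      assume "(w, \<sigma> w v) \<in> tour_at T ` {..<l}"
      then obtain i where "i < l" "tour_at T i = tour_at T l"
        using l(3) by auto
      then show False
        using inj[of i l] \<open>l < n\<close> by simp
    qed
    ultimately have "{w, \<sigma> w v} \<in> remaining T l"
      using remaining_iff w(1) by blast
    then have "succ_in \<sigma> (remaining T l) w v = \<sigma> w v"
      by (rule succ_in_next)
    then show ?thesis
      using less.hyps[of l w "\<sigma> w v"] l w(1) \<open>l < n\<close> by simp
  qed
  show ?case
  proof (cases "{x, y} \<in> T")
    case False
    have rem: "?G - {{x, y}} = remaining T (Suc k)"
      using False k(2) x y unfolding remaining_def lessThan_Suc
      by (auto simp: doubleton_eq_iff)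
    have trav: "traversed T (Suc k) = traversed T k"
      using False k(2) unfolding traversed_def lessThan_Suc by auto
    have TG': "T \<subseteq> ?G - {{x, y}}"
      unfolding rem using T_subset[OF T] by (rule tree_subset_remaining)
    then have ht: "hypertree N (?G - {{x, y}}) X f"
      using T deg unfolding hypertree_def spanning_tree_def by blast
    have "fst (run (?G, (x, y), traversed T k)) =
        fst (run (remaining T (Suc k), (x, succ_in \<sigma> (remaining T (Suc k)) x y), traversed T (Suc k)))"
    proof -
      \<comment> \<open>A tree edge at \<open>x\<close> survives, as \<open>succ_in_delete\<close>
        requires.\<close>
      have "x \<in> N"
        using x by simp
      then obtain z where "{x, z} \<in> T"
        using spanning_tree_edge[OF T] by metis
      then have "succ_in \<sigma> ?G x y = succ_in \<sigma> (remaining T (Suc k)) x y"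
        using TG' succ_in_delete[OF xyB(1), of z ?G] remaining_subset unfolding rem by blast
      then show ?thesis
        using ht by (subst while_unfold) (simp add: rem trav)
    qed
    also have "\<dots> = T"
      using k x xyB(1) False by (intro continue) (auto simp: tour_at_Suc tour_step.simps)
    finally show ?thesis .
  next
    case True
    then have yxT: "{y, x} \<in> T"
      by (simp add: insert_commute)
    have TG: "T \<subseteq> ?G"
      using T_subset[OF T] by (rule tree_subset_remaining)
    have nht: "\<not> hypertree N (?G - {{x, y}}) X f"
      using not_removable[OF k x True] .
    define w where "w = succ_in \<sigma> ?G y x"
    \<comment> \<open>\<open>r\<close> counts the tour positions at \<open>y\<close> from the
      arrival to the next edge still present.\<close>
    obtain r where r: "1 \<le> r" "w = (\<sigma> y ^^ r) x" "{y, (\<sigma> y ^^ r) x} \<in> ?G"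
      "\<And>s. 1 \<le> s \<Longrightarrow> s < r \<Longrightarrow> {y, (\<sigma> y ^^ s) x} \<notin> ?G"
      using succ_in_steps[OF xyB(2), of x ?G] yxT TG remaining_subset unfolding w_def by blast
    have tr_y: "tour_at T (k + s) = (y, (\<sigma> y ^^ s) x)" if "1 \<le> s" "s \<le> r" for s
      using that
    proof (induction s rule: dec_induct)
      case base
      then show ?case
        using k(2) True by (simp add: tour_at_Suc tour_step.simps)
    next
      case (step s)
      then have "{y, (\<sigma> y ^^ s) x} \<notin> T"
        using r(4)[of s] TG by auto
      then show ?case
        using step by (simp add: tour_at_Suc tour_step.simps)
    qed
    \<comment> \<open>Otherwise the tour, one period after \<open>k\<close>, would be at
      \<open>y\<close> instead of back at \<open>x\<close>.\<close>
    have "r < n"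
    proof (rule ccontr)
      assume "\<not> r < n"
      then have "tour_at T (k + n) = (y, (\<sigma> y ^^ n) x)"
        using k(1) by (intro tr_y) auto
      then show False
        using tour_at_period[OF T, of k] k(2) x y(2) by simp
    qed
    have yw: "{y, w} \<in> ?G" "{w, y} \<in> ?G"
      using r(2,3) by (auto simp: insert_commute)
    then have ywB: "{w, y} \<in> B" "{y, w} \<in> B"
      using remaining_subset by blast+
    then have w: "w \<in> C"
      using edge_cases y(2) by blast
    have only_y: "j \<le> k" if "c \<in> C" "tour_at T j = (c, d)" "j < n" "j \<le> k + r" for c d j
      using tr_y[of "j - k"] that y(2) by (cases "j \<le> k") auto
    \<comment> \<open>As a non-edge, \<open>yw\<close> would have been met from \<open>w\<close>
      before \<open>(y, w)\<close>, hence before time \<open>k\<close>, and would be gone. The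
      position of \<open>(y, w)\<close> is \<open>k + r\<close>, or \<open>k + r - n\<close> if the
      tour wraps around.\<close>
    have ywT: "{y, w} \<in> T"
    proof (rule ccontr)
      assume nT: "{y, w} \<notin> T"
      then have "{w, y} \<notin> T"
        by (simp add: insert_commute)
      then obtain i j where ij: "i < j" "j < n" "tour_at T i = (w, y)" "tour_at T j = (y, w)"
        using jaeger_cut w ywB by metis
      have "j \<le> k + r"
      proof (cases "k + r < n")
        case True
        then show ?thesis
          using inj[of j "k + r"] ij tr_y[of r] r by simp
      next
        case False
        then have "tour_at T (k + r - n) = (y, w)"
          using tour_at_period[OF T, of "k + r - n"] tr_y[of r] r by simp
        then show ?thesis
          using inj[of j "k + r - n"] ij k(1) \<open>r < n\<close> by simp
      qed
      then have "i \<le> k"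
        using only_y[of w i y] ij w by simp
      moreover have "i \<noteq> k"
        using ij(3) k(2) True \<open>{w, y} \<notin> T\<close> by auto
      ultimately have "(w, y) \<in> tour_at T ` {..<k}"
        using ij(3) by (metis imageI lessThan_iff le_neq_implies_less)
      then show False
        using yw(2) remaining_iff[OF w ywB(1)] \<open>{w, y} \<notin> T\<close> by simp
    qed
    show ?thesis
    proof (cases "k + r < n")
      case False
      \<comment> \<open>The tour closes up during the rotation about \<open>y\<close>, so
        \<open>b0 = y\<close>. Hence \<open>yw\<close> was traversed from \<open>y\<close> earlier
        and no time at \<open>C\<close> is left after \<open>k\<close>: the process stops with
        \<open>T\<close>.\<close>
      have "tour_at T (k + r - n) = (y, w)"
        using tour_at_period[OF T, of "k + r - n"] tr_y[of r] r False by simp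
      moreover have "k + r - n < k"
        using k(1) \<open>r < n\<close> False by linarith
      ultimately have "(y, w) \<in> traversed T k"
        using ywT unfolding traversed_def by (auto intro: rev_image_eqI)
      moreover have "?G = T"
      proof (rule remaining_all)
        fix c d j
        assume "c \<in> C" "{c, d} \<notin> T" "tour_at T j = (c, d)" "j < n"
        then show "j < k"
          using only_y[of c j d] False k(2) True by (cases "j = k") auto
      qed
      ultimately show ?thesis
        using nht by (subst while_unfold) (simp add: w_def)
    next
      case kr: True
      \<comment> \<open>The next time at a node of \<open>C\<close>, just after \<open>yw\<close>
        has been crossed.\<close>
      define l where "l = Suc (k + r)"
      have trkr: "tour_at T (k + r) = (y, w)"
        using tr_y[of r] r by simp
      have notin: "tour_at T j \<notin> tour_at T ` {..<k}" if "k \<le> j" "j < n" for j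
      proof
        assume "tour_at T j \<in> tour_at T ` {..<k}"
        then obtain i where "i < k" "tour_at T j = tour_at T i"
          by auto
        then show False
          using inj[of j i] that by simp
      qed
      have "(x, y) \<notin> traversed T k" "(y, w) \<notin> traversed T k"
        using notin[of k] notin[of "k + r"] k kr trkr unfolding traversed_def by auto
      then have nstop: "\<not> bernardi_stops N \<sigma> X f (?G, (x, y), traversed T k)"
        by (simp add: w_def)
      \<comment> \<open>From \<open>k\<close> on, only the times \<open>k\<close> and
        \<open>k + r\<close> concern edges of \<open>T\<close>; those in between pass missing edges
        at \<open>y\<close>, so they change neither the graph nor the traversals.\<close>
      have lt: "{..<l} = {..<k} \<union> {k} \<union> {k + r} \<union> {k<..<k + r}"
        using r(1) unfolding l_def by auto
      have mid: "\<exists>s. 1 \<le> s \<and> s < r \<and> tour_at T j = (y, (\<sigma> y ^^ s) x)" if "j \<in> {k<..<k + r}" for j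
        using that tr_y[of "j - k"] by (intro exI[of _ "j - k"]) auto
      have midT: "fst (tour_at T j) \<notin> C \<and> {fst (tour_at T j), snd (tour_at T j)} \<notin> T" if "j \<in> {k<..<k + r}" for j
        using mid[OF that] r(4) y(2) TG by auto
      have rem: "remaining T l = ?G"
      proof -
        have iff: "e \<in> T \<or> (c, d) \<notin> tour_at T ` {..<l} \<longleftrightarrow> e \<in> T \<or> (c, d) \<notin> tour_at T ` {..<k}"
          if "c \<in> C" "e = {c, d}" for e c d
        proof -
          have "(c, d) \<noteq> tour_at T (k + r)"
            using that(1) trkr y(2) by auto
          moreover have "(c, d) \<notin> tour_at T ` {k<..<k + r}"
            using that(1) midT by (metis fst_conv imageE)
          moreover have "(c, d) = tour_at T k \<Longrightarrow> e \<in> T"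
            using that(2) k(2) True by simp
          ultimately show ?thesis
            unfolding lt image_Un by auto
        qed
        then show ?thesis
          unfolding remaining_def
          by (intro Collect_cong conj_cong ball_cong iff_allI imp_cong refl) (rule iff)
      qed
      have trav: "traversed T l = insert (x, y) (insert (y, w) (traversed T k))"
      proof -
        have mid_out: "{a, b} \<notin> T" if ab: "(a, b) \<in> tour_at T ` {k<..<k + r}" for a b
        proof -
          obtain j where "(a, b) = tour_at T j" "j \<in> {k<..<k + r}"
            by (rule imageE[OF ab])
          then show ?thesis
            using midT[of j] by (metis fst_conv snd_conv)
        qed
        have img: "tour_at T ` {..<l} = insert (x, y) (insert (y, w) (tour_at T ` {..<k})) \<union> tour_at T ` {k<..<k + r}"
          unfolding lt image_Un using k(2) trkr by (simp add: insert_commute)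
        have "{a, b} \<in> T \<and> (a, b) \<in> tour_at T ` {..<l} \<longleftrightarrow>
            (a, b) = (x, y) \<or> (a, b) = (y, w) \<or> {a, b} \<in> T \<and> (a, b) \<in> tour_at T ` {..<k}" for a b
          unfolding img using mid_out[of a b] True ywT by blast
        then show ?thesis
          unfolding traversed_def by (simp only:) blast
      qed
      have "fst (run (?G, (x, y), traversed T k)) =
          fst (run (remaining T l, (w, succ_in \<sigma> (remaining T l) w y), traversed T l))"
        using nht nstop by (subst while_unfold) (simp add: rem trav w_def Let_def)
      also have "\<dots> = T"
      proof (rule continue)
        show "tour_at T l = (w, \<sigma> w y)"
          using trkr ywT by (simp add: l_def tour_at_Suc tour_step.simps)
      qed (use kr w ywB in \<open>auto simp: l_def\<close>)
      finally show ?thesis .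
    qed
  qed
qed

text \<open>The initial state is the simulated state at time 0 if \<open>b0\<close> is in
  \<open>C\<close>, and at time 1, after crossing the base edge, otherwise.\<close>

lemma outcome_jaeger_tree: "bernardi_outcome N B \<sigma> b0 b1 X C f = T"
proof -
  note T = jaeger_spanning
  have pos: "0 < n"
    using tour_length[OF T] by linarith
  have init: "remaining T 0 = B" "traversed T 0 = {}"
    by (auto simp: remaining_def traversed_def)
  show ?thesis
  proof (cases "b0 \<in> C")
    case True
    then show ?thesis
      using run_tour[OF pos, of b0 b1] init by (simp add: bernardi_outcome_def bernardi_init_def)
  next
    case False
    then have b: "b0 \<in> D" "b1 \<in> C"
      using base edge_cases by blast+
    have b10: "{b1, b0} \<in> B"
      using base by (simp add: insert_commute)
    \<comment> \<open>A non-edge would have to be met from \<open>b1\<close> before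
      \<open>(b0, b1)\<close>, which is the very first pair of the tour.\<close>
    have bT: "{b0, b1} \<in> T"
    proof (rule ccontr)
      assume "{b0, b1} \<notin> T"
      then have "{b1, b0} \<notin> T"
        by (simp add: insert_commute)
      then obtain i j where "i < j" "j < n" "tour_at T j = (b0, b1)"
        using jaeger_cut[OF b(2) b10] by metis
      then show False
        using tour_at_inj[OF T, of j 0] pos by simp
    qed
    then have tr1: "tour_at T 1 = (b1, \<sigma> b1 b0)"
      by (simp add: tour_at_Suc tour_step.simps)
    have "1 < n"
    proof -
      obtain i where i: "i < n" "tour_at T i = (b1, b0)"
        using tour_at_ex[OF T b10] by metis
      have "i \<noteq> 0"
      proof
        assume "i = 0"
        then have "b0 = b1"
          using i(2) tour_at_0 by (metis prod.inject)
        then show False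
          using b(2) False by simp
      qed
      then show ?thesis
        using i by linarith
    qed
    moreover have "remaining T 1 = B" "traversed T 1 = {(b0, b1)}"
      using bT False by (auto simp: remaining_def traversed_def)
    ultimately show ?thesis
      using run_tour[OF _ tr1 b(2)] False by (simp add: bernardi_outcome_def bernardi_init_def)
  qed
qed

end

text \<open>A hypertree is realized by some Jaeger tree, which the process then finds; conversely a
  Jaeger tree is the outcome for its own degrees.\<close>

theorem outcomes_jaeger_trees:
  assumes X: "X = C \<or> X = D"
  shows "bernardi_outcomes N B \<sigma> b0 b1 X C = {T. jaeger_tree N B \<sigma> b0 b1 C T}"
proof (intro set_eqI iffI)
  fix T
  assume "T \<in> bernardi_outcomes N B \<sigma> b0 b1 X C"
  then obtain f where f: "hypertree N B X f" "T = bernardi_outcome N B \<sigma> b0 b1 X C f"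
    by (auto simp: bernardi_outcomes_def)
  obtain T' where T': "jaeger_tree N B \<sigma> b0 b1 C T'" "\<And>x. x \<in> X \<Longrightarrow> degree T' x = f x + 1"
    using hypertree_jaeger_tree[OF X f(1)] by metis
  then show "T \<in> {T. jaeger_tree N B \<sigma> b0 b1 C T}"
    using outcome_jaeger_tree[OF X T'] f(2) by simp
next
  fix T
  assume "T \<in> {T. jaeger_tree N B \<sigma> b0 b1 C T}"
  then have J: "jaeger_tree N B \<sigma> b0 b1 C T" and T: "spanning_tree N B T"
    by (simp_all add: jaeger_tree_def)
  \<comment> \<open>Connectedness makes the degrees on \<open>X\<close> positive, so the truncated
    subtraction is harmless.\<close>
  define f where "f x = degree T x - 1" for x
  have deg: "degree T x = f x + 1" if "x \<in> X" for x
  proof -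
    have "x \<in> N"
      using that X by auto
    then obtain z where z: "{x, z} \<in> T"
      using spanning_tree_edge[OF T] by metis
    have "finite T"
      using T_subset[OF T] finite_B finite_subset by blast
    then have "degree T x > 0"
      unfolding degree_def using z by (subst card_gt_0_iff) auto
    then show ?thesis
      by (simp add: f_def)
  qed
  then have "hypertree N B X f"
    using T by (auto simp: hypertree_def)
  then show "T \<in> bernardi_outcomes N B \<sigma> b0 b1 X C"
    using outcome_jaeger_tree[OF X J deg] unfolding bernardi_outcomes_def by blast
qed

end

theorem theorem6p17:
  fixes V :: "'v set" and E :: "'e set" and inc :: "'e \<Rightarrow> 'v set"
    and \<sigma> :: "('v + 'e) \<Rightarrow> ('v + 'e) \<Rightarrow> ('v + 'e)" and b0 b1 :: "'v + 'e"
  defines "N \<equiv> bip_nodes V E" and "B \<equiv> bip_edges E inc"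
  assumes "hypergraph V E inc"
    and "connected_graph N B"
    and "ribbon_structure N B \<sigma>"
    and "{b0, b1} \<in> B"
  shows "bernardi_outcomes N B \<sigma> b0 b1 (emerald E) (violet V)
           = {T. jaeger_tree N B \<sigma> b0 b1 (violet V) T}
         \<and> bernardi_outcomes N B \<sigma> b0 b1 (violet V) (violet V)
           = {T. jaeger_tree N B \<sigma> b0 b1 (violet V) T}
         \<and> bernardi_outcomes N B \<sigma> b0 b1 (emerald E) (emerald E)
           = {T. jaeger_tree N B \<sigma> b0 b1 (emerald E) T}
         \<and> bernardi_outcomes N B \<sigma> b0 b1 (violet V) (emerald E)
           = {T. jaeger_tree N B \<sigma> b0 b1 (emerald E) T}"
proof -
  have fin: "finite (violet V)" "finite (emerald E)"
    using assms(3) by (auto simp: hypergraph_def violet_def emerald_def)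
  have disj: "violet V \<inter> emerald E = {}"
    by (auto simp: violet_def emerald_def)
  have edge: "\<exists>c\<in>violet V. \<exists>d\<in>emerald E. e = {c, d}" if "e \<in> B" for e
    using that assms(3) by (fastforce simp: B_def bip_edges_def hypergraph_def violet_def emerald_def)
  then have edge': "\<exists>c\<in>emerald E. \<exists>d\<in>violet V. e = {c, d}" if "e \<in> B" for e
    using that by (metis insert_commute)
  have N: "violet V \<union> emerald E = N" "emerald E \<union> violet V = N"
    by (auto simp: N_def bip_nodes_def)
  \<comment> \<open>The first parameter is the cut class; each interpretation yields the equalities
    for both choices of \<open>X\<close>.\<close>
  interpret violet: bipartite_ribbon "violet V" "emerald E" B \<sigma> b0 b1
    using fin disj edge assms(4-6) by unfold_locales (simp_all add: N)
  interpret emerald: bipartite_ribbon "emerald E" "violet V" B \<sigma> b0 b1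
    using fin disj edge' assms(4-6) by unfold_locales (simp_all add: N Int_commute)
  show ?thesis
    using violet.outcomes_jaeger_trees emerald.outcomes_jaeger_trees by (simp add: N)
qed

end
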